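(* Let $(X_i)_{i\in\mathbf{Z}}$ be a stationary sequence as described in the context, with $\|X_0\|_\infty<\infty$ and $X_0$ being $\mathcal{F}_0$-measurable. Assume that $\lim_{n\to\infty}\sigma_n^2=\sigma^2>0$ and that $\max\{\gamma_m,\delta_m\}\to0$ as $m\to\infty$, i.e. $\max\{\gamma_{m(n)},\delta_{m(n)}\}\to0$ as $n\to\infty$ for every sequence of integers $1\le m(n)\le n$ with $m(n)\to\infty$. Let $(a_n)$ be any sequence of positive real numbers satisfying $a_n\to0$ and $a_nn^{1/2}\to\infty$ as $n\to\infty$. Then for each Borel set $B\subset\mathbf{R}$, $$-\inf_{x\in B^o}\frac{x^2}{2\sigma^2}\le\liminf_{n\to\infty}a_n^2\ln\mathbf{P}(a_nW_n\in B)\le\limsup_{n\to\infty}a_n^2\ln\mathbf{P}(a_nW_n\in B)\le-\inf_{x\in\overline B}\frac{x^2}{2\sigma^2},$$ where $B^o$ and $\overline B$ denote the interior and the closure of $B$, respectively.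
   Context: Setting: $(\Omega,\mathcal{F},\mathbf{P})$ is a probability space, $T:\Omega\to\Omega$ is a bijective bimeasurable transformation preserving $\mathbf{P}$, and $X_i=X_0\circ T^i$ for $i\in\mathbf{Z}$, where $X_0$ is a real centered random variable ($\mathbf{E}X_0=0$). $\mathcal{F}_0\subseteq\mathcal{F}$ is a sub-$\sigma$-field with $\mathcal{F}_0\subseteq T^{-1}(\mathcal{F}_0)$, and $\mathcal{F}_i=T^{-i}(\mathcal{F}_0)$. $\|X\|_\infty$ is the $\mathbf{L}^\infty$-norm (smallest $u$ with $\mathbf{P}(|X|>u)=0$). Put $S_n=\sum_{i=1}^nX_i$, $W_n=S_n/\sqrt n$, $\sigma_n=\sqrt{\mathbf{E}W_n^2}$, and assume $\sigma_n>0$. For integers $1\le m\le n$ define $$\gamma_m=\frac{1}{m^{1/2}\sigma_n}\sum_{j=1}^\infty\frac1{j^{3/2}}\big\|\mathbf{E}[S_{mj}|\mathcal{F}_0]\big\|_\infty,$$ $$\delta_m^2=\frac1{m\sigma_n^2}\big\|\mathbf{E}[S_m|\mathcal{F}_0]\big\|_\infty^2+\Big\|\frac1{m\sigma_n^2}\mathbf{E}[S_m^2|\mathcal{F}_0]-1\Big\|_\infty,\qquad \delta_m\ge0$$ (these quantities depend on both $m$ and $n$). The infimum of a function over the empty set is $+\infty$, and $\ln0=-\infty$. *)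

theory Defs
  imports "HOL-Probability.Probability"
begin

text \<open>\<open>T\<^sup>i\<close> for \<open>T\<close> a bijection of \<open>space M\<close>; only its values on \<open>space M\<close> are meaningful, since
  \<open>T\<close> need not be invertible elsewhere in the type.\<close>

definition iter :: "'a measure \<Rightarrow> ('a \<Rightarrow> 'a) \<Rightarrow> int \<Rightarrow> 'a \<Rightarrow> 'a" where
  "iter M T i = (if 0 \<le> i then T ^^ nat i else inv_into (space M) T ^^ nat (- i))"

definition X :: "'a measure \<Rightarrow> ('a \<Rightarrow> 'a) \<Rightarrow> ('a \<Rightarrow> real) \<Rightarrow> int \<Rightarrow> 'a \<Rightarrow> real" where
  "X M T X0 i \<omega> = X0 (iter M T i \<omega>)"

definition S :: "'a measure \<Rightarrow> ('a \<Rightarrow> 'a) \<Rightarrow> ('a \<Rightarrow> real) \<Rightarrow> nat \<Rightarrow> 'a \<Rightarrow> real" where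
  "S M T X0 n \<omega> = (\<Sum>i = 1..int n. X M T X0 i \<omega>)"

definition W :: "'a measure \<Rightarrow> ('a \<Rightarrow> 'a) \<Rightarrow> ('a \<Rightarrow> real) \<Rightarrow> nat \<Rightarrow> 'a \<Rightarrow> real" where
  "W M T X0 n \<omega> = S M T X0 n \<omega> / sqrt (real n)"

definition sigma_n :: "'a measure \<Rightarrow> ('a \<Rightarrow> 'a) \<Rightarrow> ('a \<Rightarrow> real) \<Rightarrow> nat \<Rightarrow> real" where
  "sigma_n M T X0 n = sqrt (\<integral>\<omega>. (W M T X0 n \<omega>)\<^sup>2 \<partial>M)"

text \<open>The norms are taken in \<open>ennreal\<close>, so that the series defining \<open>\<gamma>\<close> below always has a
  value, possibly \<open>\<infinity>\<close>. For measurable \<open>f\<close>, \<open>esssup\<close> is the least \<open>u\<close> such that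
  \<open>\<bar>f\<bar> > u\<close> has measure zero.\<close>

definition norm_Linf :: "'a measure \<Rightarrow> ('a \<Rightarrow> real) \<Rightarrow> ennreal" where
  "norm_Linf M f = esssup M (\<lambda>\<omega>. ennreal \<bar>f \<omega>\<bar>)"

definition gamma ::
  "'a measure \<Rightarrow> ('a \<Rightarrow> 'a) \<Rightarrow> ('a \<Rightarrow> real) \<Rightarrow> 'a measure \<Rightarrow> nat \<Rightarrow> nat \<Rightarrow> ennreal" where
  "gamma M T X0 F0 n m =
     ennreal (1 / (sqrt (real m) * sigma_n M T X0 n)) *
     (\<Sum>k. let j = Suc k in
        ennreal (1 / real j powr (3 / 2)) * norm_Linf M (real_cond_exp M F0 (S M T X0 (m * j))))"

definition delta_sq ::
  "'a measure \<Rightarrow> ('a \<Rightarrow> 'a) \<Rightarrow> ('a \<Rightarrow> real) \<Rightarrow> 'a measure \<Rightarrow> nat \<Rightarrow> nat \<Rightarrow> ennreal" where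
  "delta_sq M T X0 F0 n m =
     ennreal (1 / (real m * (sigma_n M T X0 n)\<^sup>2)) *
       (norm_Linf M (real_cond_exp M F0 (S M T X0 m)))\<^sup>2 +
     norm_Linf M (\<lambda>\<omega>. 1 / (real m * (sigma_n M T X0 n)\<^sup>2) *
       real_cond_exp M F0 (\<lambda>\<omega>. (S M T X0 m \<omega>)\<^sup>2) \<omega> - 1)"

definition sqrt_ennreal :: "ennreal \<Rightarrow> ennreal" where
  "sqrt_ennreal x = (if x = \<infinity> then \<infinity> else ennreal (sqrt (enn2real x)))"

definition delta ::
  "'a measure \<Rightarrow> ('a \<Rightarrow> 'a) \<Rightarrow> ('a \<Rightarrow> real) \<Rightarrow> 'a measure \<Rightarrow> nat \<Rightarrow> nat \<Rightarrow> ennreal" where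
  "delta M T X0 F0 n m = sqrt_ennreal (delta_sq M T X0 F0 n m)"

text \<open>The library has \<open>ln 0 = 0\<close> on the reals, hence this variant. It is only applied to
  probabilities.\<close>

definition ln_ext :: "real \<Rightarrow> ereal" where
  "ln_ext p = (if p = 0 then -\<infinity> else ereal (ln p))"

end

theory Submission
  imports Defs
begin

text \<open>
  Write \<open>S\<^sub>n\<close> for the partial sums and \<open>v = \<sigma>\<^sup>2\<close>. By Chernoff's bound (\<open>tail_le\<close>) and an exponential
  change of measure (\<open>window_ge\<close>), the moderate deviation principle follows as soon as the
  logarithmic moment generating functions have the Gaussian limit
  \<open>a\<^sub>n\<^sup>2 ln E exp (c W\<^sub>n / a\<^sub>n) \<longrightarrow> c\<^sup>2 v / 2\<close> for every real \<open>c\<close>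
  (\<open>mgf_eventually_le\<close>, \<open>mgf_eventually_ge\<close>). The exponent is \<open>t S\<^sub>n\<close> with \<open>t = c / (a\<^sub>n n\<^sup>1\<^sup>/\<^sup>2) \<longrightarrow> 0\<close>, and the
  relevant scale for the logarithm is \<open>n t\<^sup>2\<close>.

  Fix a block length \<open>m\<close>. Up to fewer than \<open>m\<close> bounded summands, \<open>S\<^sub>n\<close> is the sum over the blocks of
  length \<open>m\<close> of the block sum minus its conditional mean given the past, which is a martingale,
  and of these conditional means, called drifts below. The martingale has increments bounded by
  \<open>2 m C\<close>, where \<open>C\<close> bounds \<open>X0\<close>, and, up to a relative error that is small for large \<open>m\<close>, conditional variances \<open>m v\<close> (this
  is what \<open>delta\<close> controls), so a second-order expansion of the exponential gives its moment
  generating function up to the same relative error (\<open>integral_exp_mart_sum\<close>).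

  The sum of the drifts is subgaussian with variance proxy \<open>n\<close> times a small constant
  (\<open>subgaussian_drift_sum\<close>); this is where \<open>gamma\<close> enters. Adding neighbouring blocks in pairs
  replaces the drifts for length \<open>m\<close> by those for length \<open>2 m\<close>, at the price of another martingale,
  whose increments are bounded by a multiple of the norm of the drift for length \<open>m\<close>. Iterating over
  dyadic lengths and applying Azuma's inequality at each level yields the series
  \<open>\<Sum>k. 2\<^sup>-\<^sup>k\<^sup>/\<^sup>2 \<parallel>E(S\<^bsub>m 2^k\<^esub> | F)\<parallel>\<close>, which subadditivity bounds by the series in \<open>gamma\<close>
  (\<open>dyadic_sum_le\<close>). Hoelder's inequality then recombines the martingale and the drifts.

  To avoid conditional expectations with respect to the shifted \<open>\<sigma>\<close>-algebras, functions measurable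
  with respect to the future are pulled back by the inverse of \<open>T\<close>, and conditional statements are
  expressed through integrals against bounded \<open>F\<close>-measurable functions.
\<close>

section \<open>Elementary inequalities\<close>

lemma exp_le_self_plus_exp_square: "exp x \<le> x + exp (x\<^sup>2)" for x :: real
proof -
  have sq: "1 + x\<^sup>2 \<le> exp (x\<^sup>2)"
    by (rule exp_ge_add_one_self)
  consider "x \<le> 0" | "0 \<le> x" "x \<le> 1" | "1 \<le> x"
    by linarith
  then show ?thesis
  proof cases
    case 1
    obtain t where t: "exp x = (\<Sum>m<3. x ^ m / fact m) + exp t / fact 3 * x ^ 3"
      using Maclaurin_exp_le[of x 3] by blast
    have "x ^ 3 \<le> 0"
      using 1 by (simp add: power_le_zero_eq)
    then have "exp t / fact 3 * x ^ 3 \<le> 0"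
      by (intro mult_nonneg_nonpos) auto
    then have "exp x \<le> 1 + x + x\<^sup>2 / 2"
      using t by (simp add: numeral_3_eq_3 power2_eq_square)
    also have "\<dots> \<le> 1 + x + x\<^sup>2"
      by simp
    finally show ?thesis
      using sq by linarith
  next
    case 2
    then show ?thesis
      using exp_bound[of x] sq by linarith
  next
    case 3
    then have "x \<le> x\<^sup>2"
      by (simp add: power2_eq_square)
    then have "exp x \<le> exp (x\<^sup>2)"
      by simp
    then show ?thesis
      using 3 by linarith
  qed
qed

lemma exp_second_order_bound:
  assumes "\<bar>x\<bar> \<le> (1::real)"
  shows "\<bar>exp x - (1 + x + x\<^sup>2 / 2)\<bar> \<le> \<bar>x\<bar> ^ 3"
proof -
  obtain t where le: "\<bar>t\<bar> \<le> \<bar>x\<bar>" and t: "exp x = (\<Sum>m<3. x ^ m / fact m) + exp t / fact 3 * x ^ 3"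
    using Maclaurin_exp_le[of x 3] by blast
  have eq: "exp x - (1 + x + x\<^sup>2 / 2) = exp t / 6 * x ^ 3"
    using t by (simp add: numeral_3_eq_3 power2_eq_square)
  have "exp t \<le> 6"
    using exp_le le assms by (smt (verit) exp_le_cancel_iff)
  then have "exp t / 6 * \<bar>x\<bar> ^ 3 \<le> 1 * \<bar>x\<bar> ^ 3"
    by (intro mult_right_mono) auto
  then show ?thesis
    unfolding eq by (simp add: abs_mult power_abs)
qed

text \<open>For a subadditive sequence the series over dyadic indices with weights \<open>2\<^sup>-\<^sup>k\<^sup>/\<^sup>2\<close> is controlled by
  the full series with weights \<open>j\<^sup>-\<^sup>3\<^sup>/\<^sup>2\<close>: the value at \<open>2\<^sup>k\<close> is at most twice the average of the
  sequence over \<open>{1..2\<^sup>k}\<close>.\<close>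

lemma dyadic_sum_le:
  fixes b :: "nat \<Rightarrow> real"
  assumes b0: "\<And>n. 0 \<le> b n" "b 0 = 0" and sub: "\<And>i j. b (i + j) \<le> b i + b j"
  shows "(\<Sum>k\<le>r. (1 / sqrt 2) ^ k * b (2 ^ k)) \<le> 4 * (\<Sum>j = 1..2 ^ r. b j / real j powr (3 / 2))"
proof -
  define c where "c = 1 / (2 * sqrt (2::real))"
  have c: "0 < c" "c \<le> 1 / 2"
    by (auto simp: c_def field_simps)
  have ck: "c ^ k = 1 / real (2 ^ k) powr (3 / 2)" for k
  proof -
    have "(2::real) powr (3 / 2) = 2 * sqrt 2"
      by (simp add: powr_half_sqrt[symmetric] powr_mult_base)
    moreover have "real (2 ^ k) powr (3 / 2) = (2 powr (3 / 2)) ^ k"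
      by (simp add: powr_realpow[symmetric] powr_powr mult.commute)
    ultimately show ?thesis
      by (simp add: c_def power_one_over)
  qed
  have avg: "real (2 ^ k) * b (2 ^ k) \<le> 2 * (\<Sum>j = 1..2 ^ k. b j)" for k
  proof -
    let ?N = "(2::nat) ^ k"
    have "real ?N * b ?N = (\<Sum>j = 1..?N. b ?N)"
      by simp
    also have "\<dots> \<le> (\<Sum>j = 1..?N. b j + b (?N - j))"
      by (intro sum_mono) (metis sub atLeastAtMost_iff le_add_diff_inverse)
    also have "\<dots> = (\<Sum>j = 1..?N. b j) + (\<Sum>j = 1..?N. b (?N - j))"
      by (rule sum.distrib)
    also have "(\<Sum>j = 1..?N. b (?N - j)) = (\<Sum>j<?N. b j)"
      by (rule sum.reindex_bij_witness[of _ "\<lambda>j. ?N - j" "\<lambda>j. ?N - j"]) auto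
    also have "\<dots> \<le> (\<Sum>j\<le>?N. b j)"
      by (intro sum_mono2) (auto simp: b0)
    also have "\<dots> = (\<Sum>j = 1..?N. b j)"
      using sum.atLeast_Suc_atMost[of 0 ?N b] by (simp add: b0 atMost_atLeast0)
    finally show ?thesis
      by simp
  qed
  have summand: "(1 / sqrt 2) ^ k * b (2 ^ k) \<le> (\<Sum>j = 1..2 ^ r. if j \<le> 2 ^ k then 2 * c ^ k * b j else 0)"
    if "k \<le> r" for k
  proof -
    have "(1 / sqrt 2) ^ k * b (2 ^ k) = (2 * c) ^ k * b (2 ^ k)"
      by (simp add: c_def)
    also have "\<dots> = c ^ k * (real (2 ^ k) * b (2 ^ k))"
      by (simp add: power_mult_distrib)
    also have "\<dots> \<le> c ^ k * (2 * (\<Sum>j = 1..2 ^ k. b j))"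
      by (intro mult_left_mono avg) (use c in auto)
    also have "\<dots> = (\<Sum>j = 1..2 ^ k. 2 * c ^ k * b j)"
      by (simp add: sum_distrib_left mult_ac)
    also have "\<dots> = (\<Sum>j \<in> {j \<in> {1..2 ^ r}. j \<le> 2 ^ k}. 2 * c ^ k * b j)"
    proof (rule sum.cong)
      have "(2::nat) ^ k \<le> 2 ^ r"
        using that by simp
      then show "{1..2 ^ k} = {j \<in> {1..2 ^ r}. j \<le> (2::nat) ^ k}"
        by (auto intro: order_trans)
    qed simp
    also have "\<dots> = (\<Sum>j = 1..2 ^ r. if j \<le> 2 ^ k then 2 * c ^ k * b j else 0)"
      by (rule sum.inter_filter) simp
    finally show ?thesis .
  qed
  have geom: "(\<Sum>k\<le>r. if j \<le> 2 ^ k then c ^ k else 0) \<le> 2 / real j powr (3 / 2)" if "1 \<le> j" for j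
  proof -
    define k0 where "k0 = (LEAST k. j \<le> 2 ^ k)"
    have "j \<le> 2 ^ j"
      by (simp add: less_imp_le)
    then have k0: "j \<le> 2 ^ k0" "\<And>k. j \<le> 2 ^ k \<Longrightarrow> k0 \<le> k"
      unfolding k0_def by (auto intro: LeastI[of "\<lambda>k. j \<le> 2 ^ k" j] Least_le[of "\<lambda>k. j \<le> 2 ^ k"])
    have "(\<Sum>k\<le>r. if j \<le> 2 ^ k then c ^ k else 0) \<le> (\<Sum>k\<le>r. if k0 \<le> k then c ^ k else 0)"
      using c k0 by (intro sum_mono) auto
    also have "\<dots> = (\<Sum>k \<in> {k \<in> {..r}. k0 \<le> k}. c ^ k)"
      by (rule sum.inter_filter[symmetric]) simp
    also have "{k \<in> {..r}. k0 \<le> k} = {k0..r}"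
      by auto
    also have "(\<Sum>k \<in> {k0..r}. c ^ k) \<le> 2 * c ^ k0"
    proof (cases "k0 \<le> r")
      case True
      have *: "(1 - c) * (\<Sum>k \<in> {k0..r}. c ^ k) = c ^ k0 - c ^ Suc r"
        using sum_gp_multiplied[OF True, of c] by simp
      have "1 / 2 * (\<Sum>k \<in> {k0..r}. c ^ k) \<le> (1 - c) * (\<Sum>k \<in> {k0..r}. c ^ k)"
        using c by (intro mult_right_mono sum_nonneg) auto
      also have "\<dots> \<le> c ^ k0"
        using * c by simp
      finally show ?thesis
        by simp
    qed (use c in auto)
    also have "\<dots> \<le> 2 * (1 / real j powr (3 / 2))"
      unfolding ck
      by (intro mult_left_mono divide_left_mono powr_mono2 mult_pos_pos)
        (use k0 that in \<open>auto simp del: of_nat_power\<close>)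
    finally show ?thesis
      by simp
  qed
  have "(\<Sum>k\<le>r. (1 / sqrt 2) ^ k * b (2 ^ k))
      \<le> (\<Sum>k\<le>r. \<Sum>j = 1..2 ^ r. if j \<le> 2 ^ k then 2 * c ^ k * b j else 0)"
    by (intro sum_mono summand) auto
  also have "\<dots> = (\<Sum>j = 1..2 ^ r. \<Sum>k\<le>r. if j \<le> 2 ^ k then 2 * c ^ k * b j else 0)"
    by (rule sum.swap)
  also have "\<dots> = (\<Sum>j = 1..2 ^ r. 2 * b j * (\<Sum>k\<le>r. if j \<le> 2 ^ k then c ^ k else 0))"
    unfolding sum_distrib_left by (intro sum.cong refl) auto
  also have "\<dots> \<le> (\<Sum>j = 1..2 ^ r. 2 * b j * (2 / real j powr (3 / 2)))"
    by (intro sum_mono mult_left_mono geom) (auto simp: b0)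
  also have "\<dots> = 4 * (\<Sum>j = 1..2 ^ r. b j / real j powr (3 / 2))"
    by (simp add: sum_distrib_left)
  finally show ?thesis .
qed

section \<open>Measure-preserving bijections and essentially bounded functions\<close>

text \<open>A measure-preserving bijection \<open>T\<close> with measurable inverse \<open>V\<close>, and a sub-\<open>\<sigma>\<close>-algebra \<open>F\<close>.
  The filtration condition \<open>F \<subseteq> T\<^sup>-\<^sup>1 F\<close> is encoded as measurability of \<open>V\<close> with respect to \<open>F\<close>; thus
  \<open>f \<circ> V\<^sup>k\<close> is \<open>F\<close>-measurable exactly when \<open>f\<close> is measurable with respect to \<open>T\<^sup>-\<^sup>k F\<close>.\<close>

locale invertible_system = prob_space M for M :: "'a measure" +
  fixes F :: "'a measure" and T V :: "'a \<Rightarrow> 'a"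
  assumes subalg_F: "subalgebra M F"
    and T_meas [measurable]: "T \<in> measurable M M"
    and V_meas [measurable]: "V \<in> measurable M M"
    and V_meas_F: "V \<in> measurable F F"
    and VT: "\<And>x. x \<in> space M \<Longrightarrow> V (T x) = x"
    and TV: "\<And>x. x \<in> space M \<Longrightarrow> T (V x) = x"
    and distr_T: "distr M M T = M"

sublocale invertible_system \<subseteq> finite_measure_subalgebra M F
  by unfold_locales (rule subalg_F)

context invertible_system
begin

lemma space_F: "space F = space M"
  using subalg_F by (simp add: subalgebra_def)

lemma meas_F_M: "f \<in> borel_measurable F \<Longrightarrow> f \<in> borel_measurable M"
  by (rule measurable_from_subalg[OF subalg_F])

lemma Tk_meas [measurable]: "T ^^ k \<in> measurable M M"
proof (induction k)
  case (Suc k)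
  then show ?case
    using measurable_comp[OF Suc T_meas] by (simp add: o_def)
qed (simp add: id_def)

lemma Vk_meas [measurable]: "V ^^ k \<in> measurable M M"
proof (induction k)
  case (Suc k)
  then show ?case
    using measurable_comp[OF Suc V_meas] by (simp add: o_def)
qed (simp add: id_def)

lemma Vk_meas_F: "V ^^ k \<in> measurable F F"
proof (induction k)
  case (Suc k)
  then show ?case
    using measurable_comp[OF Suc V_meas_F] by (simp add: o_def)
qed (simp add: id_def)

lemma Tk_space: "x \<in> space M \<Longrightarrow> (T ^^ k) x \<in> space M"
  using Tk_meas by (rule measurable_space)

lemma Vk_space: "x \<in> space M \<Longrightarrow> (V ^^ k) x \<in> space M"
  using Vk_meas by (rule measurable_space)

lemma TkVk: "x \<in> space M \<Longrightarrow> (T ^^ k) ((V ^^ (k + j)) x) = (V ^^ j) x"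
proof (induction k)
  case (Suc k)
  have "(T ^^ Suc k) ((V ^^ (Suc k + j)) x) = (T ^^ k) (T (V ((V ^^ (k + j)) x)))"
    by (simp add: funpow_swap1)
  then show ?case
    using Suc by (simp add: TV Vk_space)
qed simp

lemma VkTk: "x \<in> space M \<Longrightarrow> (V ^^ k) ((T ^^ k) x) = x"
proof (induction k)
  case (Suc k)
  have "(V ^^ Suc k) ((T ^^ Suc k) x) = (V ^^ k) (V (T ((T ^^ k) x)))"
    by (simp add: funpow_swap1)
  then show ?case
    using Suc by (simp add: VT Tk_space)
qed simp

lemma distr_Tk: "distr M M (T ^^ k) = M"
proof (induction k)
  case 0
  show ?case
    using distr_id[of M] by (simp add: id_def)
next
  case (Suc k)
  have "distr M M (T ^^ Suc k) = distr (distr M M (T ^^ k)) M T"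
    by (subst distr_distr) auto
  also have "\<dots> = M"
    by (simp only: Suc distr_T)
  finally show ?case .
qed

lemma distr_Vk: "distr M M (V ^^ k) = M"
proof -
  have "distr M M (V ^^ k) = distr (distr M M (T ^^ k)) M (V ^^ k)"
    by (simp add: distr_Tk)
  also have "\<dots> = distr M M (\<lambda>x. (V ^^ k) ((T ^^ k) x))"
    by (subst distr_distr) (auto simp: o_def)
  also have "\<dots> = distr M M (\<lambda>x. x)"
    by (intro distr_cong refl) (simp add: VkTk)
  finally show ?thesis
    using distr_id[of M] by simp
qed

lemma integral_Tk:
  assumes "f \<in> borel_measurable M"
  shows "(\<integral>x. f ((T ^^ k) x) \<partial>M) = (\<integral>x. f x \<partial>M :: real)"
  using integral_distr[OF Tk_meas assms, of k] by (simp add: distr_Tk)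

lemma integral_Vk:
  assumes "f \<in> borel_measurable M"
  shows "(\<integral>x. f ((V ^^ k) x) \<partial>M) = (\<integral>x. f x \<partial>M :: real)"
  using integral_distr[OF Vk_meas assms, of k] by (simp add: distr_Vk)

lemma AE_Tk: "AE x in M. P x \<Longrightarrow> AE x in M. P ((T ^^ k) x)"
  using AE_distrD[OF Tk_meas, of P k] unfolding distr_Tk .

lemma AE_Vk: "AE x in M. P x \<Longrightarrow> AE x in M. P ((V ^^ k) x)"
  using AE_distrD[OF Vk_meas, of P k] unfolding distr_Vk .

text \<open>Essentially bounded measurable functions; on a probability space these are closed under all
  operations used below and integrable.\<close>

definition ebdd :: "('a \<Rightarrow> real) \<Rightarrow> bool" where
  "ebdd f \<longleftrightarrow> f \<in> borel_measurable M \<and> (\<exists>K. AE x in M. \<bar>f x\<bar> \<le> K)"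

lemma ebddI: "f \<in> borel_measurable M \<Longrightarrow> AE x in M. \<bar>f x\<bar> \<le> K \<Longrightarrow> ebdd f"
  unfolding ebdd_def by blast

lemma ebdd_meas: "ebdd f \<Longrightarrow> f \<in> borel_measurable M"
  unfolding ebdd_def by blast

lemma ebddE:
  assumes "ebdd f"
  obtains K where "0 \<le> K" "AE x in M. \<bar>f x\<bar> \<le> K"
proof -
  obtain K where "AE x in M. \<bar>f x\<bar> \<le> K"
    using assms unfolding ebdd_def by blast
  then have "AE x in M. \<bar>f x\<bar> \<le> max K 0"
    by eventually_elim auto
  then show ?thesis
    using that[of "max K 0"] by simp
qed

lemma ebdd_integrable: "ebdd f \<Longrightarrow> integrable M f"
  unfolding ebdd_def using integrable_const_bound[of f] by auto

lemma ebdd_const [simp]: "ebdd (\<lambda>x. c)"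
  by (rule ebddI[of _ "\<bar>c\<bar>"]) auto

lemma ebdd_add: assumes "ebdd f" "ebdd g" shows "ebdd (\<lambda>x. f x + g x)"
proof -
  obtain K where K: "AE x in M. \<bar>f x\<bar> \<le> K"
    using assms(1) by (rule ebddE)
  obtain L where L: "AE x in M. \<bar>g x\<bar> \<le> L"
    using assms(2) by (rule ebddE)
  from K L have "AE x in M. \<bar>f x + g x\<bar> \<le> K + L"
    by eventually_elim linarith
  then show ?thesis
    using assms[THEN ebdd_meas] by (intro ebddI) auto
qed

lemma ebdd_mult: assumes "ebdd f" "ebdd g" shows "ebdd (\<lambda>x. f x * g x)"
proof -
  obtain K where K: "0 \<le> K" "AE x in M. \<bar>f x\<bar> \<le> K"
    using assms(1) by (rule ebddE)
  obtain L where L: "AE x in M. \<bar>g x\<bar> \<le> L"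
    using assms(2) by (rule ebddE)
  from K(2) L have "AE x in M. \<bar>f x * g x\<bar> \<le> K * L"
    by eventually_elim (auto simp: abs_mult intro!: mult_mono K(1))
  then show ?thesis
    using assms[THEN ebdd_meas] by (intro ebddI) auto
qed

lemma ebdd_exp: assumes "ebdd f" shows "ebdd (\<lambda>x. exp (f x))"
proof -
  obtain K where K: "AE x in M. \<bar>f x\<bar> \<le> K"
    using assms by (rule ebddE)
  then have "AE x in M. \<bar>exp (f x)\<bar> \<le> exp K"
    by eventually_elim auto
  then show ?thesis
    using assms[THEN ebdd_meas] by (intro ebddI) auto
qed

lemma ebdd_cmult: "ebdd f \<Longrightarrow> ebdd (\<lambda>x. c * f x)"
  by (rule ebdd_mult) auto

lemma ebdd_uminus: "ebdd f \<Longrightarrow> ebdd (\<lambda>x. - f x)"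
  using ebdd_cmult[of f "-1"] by simp

lemma ebdd_diff: "ebdd f \<Longrightarrow> ebdd g \<Longrightarrow> ebdd (\<lambda>x. f x - g x)"
  using ebdd_add[of f "\<lambda>x. - g x"] by (simp add: ebdd_uminus)

lemma ebdd_power: "ebdd f \<Longrightarrow> ebdd (\<lambda>x. f x ^ n)"
  by (induction n) (auto intro: ebdd_mult)

lemma ebdd_sum: "(\<And>i. i \<in> I \<Longrightarrow> ebdd (f i)) \<Longrightarrow> ebdd (\<lambda>x. \<Sum>i\<in>I. f i x)"
  by (induction I rule: infinite_finite_induct) (auto intro: ebdd_add)

lemma ebdd_prod: "(\<And>i. i \<in> I \<Longrightarrow> ebdd (f i)) \<Longrightarrow> ebdd (\<lambda>x. \<Prod>i\<in>I. f i x)"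
  by (induction I rule: infinite_finite_induct) (auto intro: ebdd_mult)

lemma ebdd_Tk: assumes "ebdd f" shows "ebdd (\<lambda>x. f ((T ^^ k) x))"
proof -
  obtain K where K: "AE x in M. \<bar>f x\<bar> \<le> K"
    using assms by (rule ebddE)
  show ?thesis
    using AE_Tk[OF K, of k] assms[THEN ebdd_meas] by (intro ebddI) auto
qed

lemma ebdd_Vk: assumes "ebdd f" shows "ebdd (\<lambda>x. f ((V ^^ k) x))"
proof -
  obtain K where K: "AE x in M. \<bar>f x\<bar> \<le> K"
    using assms by (rule ebddE)
  show ?thesis
    using AE_Vk[OF K, of k] assms[THEN ebdd_meas] by (intro ebddI) auto
qed

lemmas ebdd_intros = ebdd_const ebdd_add ebdd_mult ebdd_exp ebdd_cmult ebdd_uminus ebdd_diff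
  ebdd_power ebdd_sum ebdd_prod ebdd_Tk ebdd_Vk

lemma norm_Linf_ebdd:
  assumes "ebdd f"
  shows "norm_Linf M f < \<infinity>" "AE x in M. \<bar>f x\<bar> \<le> enn2real (norm_Linf M f)"
proof -
  have [measurable]: "f \<in> borel_measurable M"
    using assms by (rule ebdd_meas)
  obtain K where K: "0 \<le> K" "AE x in M. \<bar>f x\<bar> \<le> K"
    using assms by (rule ebddE)
  have "norm_Linf M f \<le> ennreal K"
    unfolding norm_Linf_def using K(2) by (intro esssup_I) (auto intro: ennreal_leI)
  then show fin: "norm_Linf M f < \<infinity>"
    by (auto simp: less_top[symmetric] top_unique)
  have "AE x in M. ennreal \<bar>f x\<bar> \<le> norm_Linf M f"
    unfolding norm_Linf_def by (rule esssup_AE)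
  then show "AE x in M. \<bar>f x\<bar> \<le> enn2real (norm_Linf M f)"
  proof eventually_elim
    case (elim x)
    then show ?case
      using enn2real_mono[OF elim] fin by simp
  qed
qed

lemma abs_real_cond_exp_le:
  assumes "integrable M f" "AE x in M. \<bar>f x\<bar> \<le> K"
  shows "AE x in M. \<bar>real_cond_exp M F f x\<bar> \<le> K"
proof -
  have "AE x in M. f x \<le> K" "AE x in M. f x \<ge> - K"
    using assms(2) by (eventually_elim, linarith)+
  then have "AE x in M. real_cond_exp M F f x \<le> K" "AE x in M. real_cond_exp M F f x \<ge> - K"
    using assms(1) real_cond_exp_le_c real_cond_exp_ge_c by auto
  then show ?thesis
    by eventually_elim linarith
qed

lemma ebdd_cond_exp: assumes "ebdd f" shows "ebdd (real_cond_exp M F f)"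
proof -
  obtain K where "AE x in M. \<bar>f x\<bar> \<le> K"
    using assms by (rule ebddE)
  then have "AE x in M. \<bar>real_cond_exp M F f x\<bar> \<le> K"
    by (rule abs_real_cond_exp_le[OF ebdd_integrable[OF assms]])
  then show ?thesis
    by (rule ebddI[rotated]) simp
qed

lemma integral_mult_cond_exp:
  assumes "ebdd f" "ebdd u" "u \<in> borel_measurable F"
  shows "(\<integral>x. u x * real_cond_exp M F f x \<partial>M) = (\<integral>x. u x * f x \<partial>M)"
  using assms by (intro real_cond_exp_intg) (auto intro!: ebdd_integrable ebdd_mult ebdd_meas)

section \<open>Products along the orbit\<close>

text \<open>In the next lemmas \<open>\<phi>\<close> is measurable with respect to \<open>T\<^sup>-\<^sup>l F\<close>, so in the product of
  \<open>\<phi> \<circ> T\<^sup>i\<^sup>l\<close> over \<open>i < q\<close> the last factor can be integrated conditionally on the others. Pulling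
  everything back by \<open>V\<close> turns this into an integral of \<open>\<phi>\<close> against an \<open>F\<close>-measurable function.\<close>

definition pullback :: "('a \<Rightarrow> real) \<Rightarrow> nat \<Rightarrow> nat \<Rightarrow> 'a \<Rightarrow> real" where
  "pullback \<phi> l q x = (\<Prod>i<q. \<phi> ((V ^^ (Suc i * l)) x))"

lemma pullback_F:
  assumes "(\<lambda>x. \<phi> ((V ^^ l) x)) \<in> borel_measurable F"
  shows "pullback \<phi> l q \<in> borel_measurable F"
proof -
  have "(\<lambda>x. \<phi> ((V ^^ (Suc i * l)) x)) \<in> borel_measurable F" for i
    using measurable_comp[OF Vk_meas_F[of "i * l"] assms] by (simp add: o_def funpow_add)
  then show ?thesis
    unfolding pullback_def by (intro borel_measurable_prod) auto
qed

lemma pullback_ebdd: "ebdd \<phi> \<Longrightarrow> ebdd (pullback \<phi> l q)"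
  unfolding pullback_def by (intro ebdd_prod ebdd_Vk)

lemma pullback_nonneg: "(\<And>x. 0 \<le> \<phi> x) \<Longrightarrow> 0 \<le> pullback \<phi> l q x"
  unfolding pullback_def by (intro prod_nonneg) auto

lemma integral_pullback_Suc:
  assumes "ebdd \<phi>"
  shows "(\<integral>x. pullback \<phi> l (Suc q) x \<partial>M) = (\<integral>x. pullback \<phi> l q x * \<phi> x \<partial>M)"
proof -
  have "pullback \<phi> l (Suc q) x = (\<lambda>x. pullback \<phi> l q x * \<phi> x) ((V ^^ l) x)" for x
    unfolding pullback_def prod.lessThan_Suc_shift
    by (simp add: funpow_add[of _ l, symmetric] funpow_add[symmetric] mult.commute
        flip: comp_apply[of "V ^^ _" "V ^^ l"]) (simp add: add_ac)
  then show ?thesis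
    using integral_Vk[of "\<lambda>x. pullback \<phi> l q x * \<phi> x" l] assms
    by (simp add: ebdd_meas ebdd_mult pullback_ebdd)
qed

lemma integral_orbit_prod:
  assumes "ebdd \<phi>"
  shows "(\<integral>x. (\<Prod>i<q. \<phi> ((T ^^ (i * l)) x)) \<partial>M) = (\<integral>x. pullback \<phi> l q x \<partial>M)"
proof -
  have "(\<integral>x. (\<Prod>i<q. \<phi> ((T ^^ (i * l)) x)) \<partial>M) = (\<integral>x. (\<Prod>i<q. \<phi> ((T ^^ (i * l)) ((V ^^ (q * l)) x))) \<partial>M)"
    by (rule integral_Vk[symmetric]) (auto intro!: ebdd_meas ebdd_prod ebdd_Tk assms)
  also have "\<dots> = (\<integral>x. pullback \<phi> l q x \<partial>M)"
  proof (intro Bochner_Integration.integral_cong refl)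
    fix x assume x: "x \<in> space M"
    have "(\<Prod>i<q. \<phi> ((T ^^ (i * l)) ((V ^^ (q * l)) x))) = (\<Prod>i<q. \<phi> ((V ^^ ((q - i) * l)) x))"
    proof (intro prod.cong refl)
      fix i assume "i \<in> {..<q}"
      then have "q * l = i * l + (q - i) * l"
        by (simp add: add_mult_distrib[symmetric])
      then show "\<phi> ((T ^^ (i * l)) ((V ^^ (q * l)) x)) = \<phi> ((V ^^ ((q - i) * l)) x)"
        using TkVk[OF x, of "i * l" "(q - i) * l"] by simp
    qed
    also have "\<dots> = pullback \<phi> l q x"
      unfolding pullback_def
      by (rule prod.reindex_bij_witness[of _ "\<lambda>i. q - Suc i" "\<lambda>i. q - Suc i"]) (auto simp: Suc_diff_Suc)
    finally show "(\<Prod>i<q. \<phi> ((T ^^ (i * l)) ((V ^^ (q * l)) x))) = pullback \<phi> l q x" .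
  qed
  finally show ?thesis .
qed

lemma orbit_prod_le:
  assumes "ebdd \<phi>" "\<And>x. 0 \<le> \<phi> x" "(\<lambda>x. \<phi> ((V ^^ l) x)) \<in> borel_measurable F" "0 \<le> K"
    and "\<And>u. u \<in> borel_measurable F \<Longrightarrow> ebdd u \<Longrightarrow> (\<And>x. 0 \<le> u x) \<Longrightarrow>
      (\<integral>x. u x * \<phi> x \<partial>M) \<le> K * (\<integral>x. u x \<partial>M)"
  shows "(\<integral>x. (\<Prod>i<q. \<phi> ((T ^^ (i * l)) x)) \<partial>M) \<le> K ^ q"
  unfolding integral_orbit_prod[OF assms(1)]
proof (induction q)
  case 0
  show ?case
    by (simp add: pullback_def prob_space)
next
  case (Suc q)
  have "(\<integral>x. pullback \<phi> l (Suc q) x \<partial>M) = (\<integral>x. pullback \<phi> l q x * \<phi> x \<partial>M)"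
    by (rule integral_pullback_Suc[OF assms(1)])
  also have "\<dots> \<le> K * (\<integral>x. pullback \<phi> l q x \<partial>M)"
    by (intro assms(5) pullback_F pullback_ebdd pullback_nonneg assms)
  also have "\<dots> \<le> K * K ^ q"
    by (intro mult_left_mono Suc assms)
  finally show ?case
    by simp
qed

lemma orbit_prod_ge:
  assumes "ebdd \<phi>" "\<And>x. 0 \<le> \<phi> x" "(\<lambda>x. \<phi> ((V ^^ l) x)) \<in> borel_measurable F" "0 \<le> K"
    and "\<And>u. u \<in> borel_measurable F \<Longrightarrow> ebdd u \<Longrightarrow> (\<And>x. 0 \<le> u x) \<Longrightarrow>
      K * (\<integral>x. u x \<partial>M) \<le> (\<integral>x. u x * \<phi> x \<partial>M)"
  shows "K ^ q \<le> (\<integral>x. (\<Prod>i<q. \<phi> ((T ^^ (i * l)) x)) \<partial>M)"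
  unfolding integral_orbit_prod[OF assms(1)]
proof (induction q)
  case 0
  show ?case
    by (simp add: pullback_def prob_space)
next
  case (Suc q)
  have "K * K ^ q \<le> K * (\<integral>x. pullback \<phi> l q x \<partial>M)"
    by (intro mult_left_mono Suc assms)
  also have "\<dots> \<le> (\<integral>x. pullback \<phi> l q x * \<phi> x \<partial>M)"
    by (intro assms(5) pullback_F pullback_ebdd pullback_nonneg assms)
  also have "\<dots> = (\<integral>x. pullback \<phi> l (Suc q) x \<partial>M)"
    by (rule integral_pullback_Suc[OF assms(1), symmetric])
  finally show ?case
    by simp
qed

end

section \<open>Subgaussian functions\<close>

context invertible_system
begin

text \<open>Hoelder's inequality for exponentials, in the form of convexity of the logarithm of the
  moment generating function.\<close>

lemma integral_exp_convex:
  assumes A: "ebdd A" "(\<integral>x. exp (A x) \<partial>M) \<le> exp a" and B: "ebdd B" "(\<integral>x. exp (B x) \<partial>M) \<le> exp b"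
    and w: "0 \<le> w" "w \<le> 1"
  shows "(\<integral>x. exp (w * A x + (1 - w) * B x) \<partial>M) \<le> exp (w * a + (1 - w) * b)"
proof -
  let ?c = "exp (w * a + (1 - w) * b)"
  have int: "integrable M (\<lambda>x. exp (A x))" "integrable M (\<lambda>x. exp (B x))"
    by (intro ebdd_integrable ebdd_exp A B)+
  have pt: "exp (w * A x + (1 - w) * B x) \<le> ?c * (w * exp (- a) * exp (A x) + (1 - w) * exp (- b) * exp (B x))" for x
  proof -
    have "exp (w * A x + (1 - w) * B x) = ?c * exp (w * (A x - a) + (1 - w) * (B x - b))"
      by (simp add: algebra_simps flip: exp_add)
    also have "exp (w * (A x - a) + (1 - w) * (B x - b)) \<le> w * exp (A x - a) + (1 - w) * exp (B x - b)"
      using convex_onD[OF exp_convex, of w "B x - b" "A x - a"] w by (simp add: algebra_simps)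
    finally show ?thesis
      by (simp add: exp_diff exp_minus divide_inverse mult_ac)
  qed
  have "(\<integral>x. exp (w * A x + (1 - w) * B x) \<partial>M)
      \<le> (\<integral>x. ?c * (w * exp (- a) * exp (A x) + (1 - w) * exp (- b) * exp (B x)) \<partial>M)"
    by (intro integral_mono pt ebdd_integrable ebdd_intros A B)
  also have "\<dots> = ?c * (w * exp (- a) * (\<integral>x. exp (A x) \<partial>M) + (1 - w) * exp (- b) * (\<integral>x. exp (B x) \<partial>M))"
    using int by simp
  also have "\<dots> \<le> ?c * (w * exp (- a) * exp a + (1 - w) * exp (- b) * exp b)"
    by (intro mult_left_mono add_mono A B) (use w in auto)
  also have "\<dots> = ?c"
    by (simp add: mult.assoc flip: exp_add)
  finally show ?thesis .
qed

text \<open>Bounded functions with a Gaussian bound \<open>exp (t\<^sup>2 s\<^sup>2)\<close> on the moment generating function; they are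
  necessarily centred. The normalisation without the factor \<open>1/2\<close> in the exponent is convenient, as constants play
  no role.\<close>

definition subgaussian :: "('a \<Rightarrow> real) \<Rightarrow> real \<Rightarrow> bool" where
  "subgaussian f s \<longleftrightarrow> ebdd f \<and> (\<forall>t. (\<integral>x. exp (t * f x) \<partial>M) \<le> exp (t\<^sup>2 * s\<^sup>2))"

lemma subgaussian_ebdd: "subgaussian f s \<Longrightarrow> ebdd f"
  by (simp add: subgaussian_def)

lemma subgaussianD: "subgaussian f s \<Longrightarrow> (\<integral>x. exp (t * f x) \<partial>M) \<le> exp (t\<^sup>2 * s\<^sup>2)"
  by (simp add: subgaussian_def)

lemma subgaussian_mono:
  assumes "subgaussian f s" "0 \<le> s" "s \<le> r"
  shows "subgaussian f r"
  unfolding subgaussian_def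
proof (intro conjI allI)
  fix t
  have "t\<^sup>2 * s\<^sup>2 \<le> t\<^sup>2 * r\<^sup>2"
    using assms by (intro mult_left_mono power_mono) auto
  then show "(\<integral>x. exp (t * f x) \<partial>M) \<le> exp (t\<^sup>2 * r\<^sup>2)"
    using subgaussianD[OF assms(1), of t] by (meson exp_le_cancel_iff order_trans)
qed (use assms in \<open>simp add: subgaussian_def\<close>)

lemma subgaussian_add_pos:
  assumes f: "subgaussian f s" "0 < s" and g: "subgaussian g r" "0 < r"
  shows "subgaussian (\<lambda>x. f x + g x) (s + r)"
  unfolding subgaussian_def
proof (intro conjI allI)
  show "ebdd (\<lambda>x. f x + g x)"
    using f g by (intro ebdd_add subgaussian_ebdd)
  fix t
  \<comment> \<open>the optimal weight in the convexity bound\<close>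
  define w where "w = s / (s + r)"
  have w: "0 < w" "w < 1" "1 - w = r / (s + r)"
    using f g by (auto simp: w_def field_simps)
  have "(\<integral>x. exp (w * (t / w * f x) + (1 - w) * (t / (1 - w) * g x)) \<partial>M)
      \<le> exp (w * ((t / w)\<^sup>2 * s\<^sup>2) + (1 - w) * ((t / (1 - w))\<^sup>2 * r\<^sup>2))"
    using f g w by (intro integral_exp_convex subgaussianD ebdd_cmult subgaussian_ebdd) auto
  moreover have "w * (t / w * f x) + (1 - w) * (t / (1 - w) * g x) = t * (f x + g x)" for x
    using w(1,2) by (simp add: distrib_left)
  moreover have "w * ((t / w)\<^sup>2 * s\<^sup>2) = t\<^sup>2 * (s * (s + r))"
  proof -
    have "w * ((t / w)\<^sup>2 * s\<^sup>2) = t\<^sup>2 * (s\<^sup>2 / w)"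
      using w(1) by (simp add: power2_eq_square)
    also have "s\<^sup>2 / w = s * (s + r)"
      using f g by (simp add: w_def power2_eq_square)
    finally show ?thesis .
  qed
  moreover have "(1 - w) * ((t / (1 - w))\<^sup>2 * r\<^sup>2) = t\<^sup>2 * (r * (s + r))"
  proof -
    have "(1 - w) * ((t / (1 - w))\<^sup>2 * r\<^sup>2) = t\<^sup>2 * (r\<^sup>2 / (1 - w))"
      using w(2) by (simp add: power2_eq_square)
    also have "r\<^sup>2 / (1 - w) = r * (s + r)"
      using f g by (simp add: w(3) power2_eq_square)
    finally show ?thesis .
  qed
  ultimately show "(\<integral>x. exp (t * (f x + g x)) \<partial>M) \<le> exp (t\<^sup>2 * (s + r)\<^sup>2)"
    by (simp add: power2_eq_square algebra_simps)
qed

lemma subgaussian_add: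
  assumes f: "subgaussian f s" "0 \<le> s" and g: "subgaussian g r" "0 \<le> r"
  shows "subgaussian (\<lambda>x. f x + g x) (s + r)"
  unfolding subgaussian_def
proof (intro conjI allI)
  show "ebdd (\<lambda>x. f x + g x)"
    using f g by (intro ebdd_add subgaussian_ebdd)
  fix t
  \<comment> \<open>degenerate constants are approached by positive ones\<close>
  let ?e = "\<lambda>n. inverse (real (Suc n))"
  have "(\<lambda>n. exp (t\<^sup>2 * ((s + ?e n) + (r + ?e n))\<^sup>2)) \<longlonglongrightarrow> exp (t\<^sup>2 * ((s + 0) + (r + 0))\<^sup>2)"
    by (intro tendsto_intros LIMSEQ_inverse_real_of_nat)
  moreover have "(\<integral>x. exp (t * (f x + g x)) \<partial>M) \<le> exp (t\<^sup>2 * ((s + ?e n) + (r + ?e n))\<^sup>2)" for n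
  proof -
    have e: "0 < ?e n"
      by simp
    have "subgaussian f (s + ?e n)" "subgaussian g (r + ?e n)"
      using e by (auto intro!: subgaussian_mono[OF f(1)] subgaussian_mono[OF g(1)] f g simp del: of_nat_Suc)
    then show ?thesis
      using subgaussianD[OF subgaussian_add_pos, of f "s + ?e n" g "r + ?e n" t] e f(2) g(2)
      by (simp add: add_nonneg_pos del: of_nat_Suc)
  qed
  ultimately have "(\<integral>x. exp (t * (f x + g x)) \<partial>M) \<le> exp (t\<^sup>2 * ((s + 0) + (r + 0))\<^sup>2)"
    by (intro LIMSEQ_le_const) auto
  then show "(\<integral>x. exp (t * (f x + g x)) \<partial>M) \<le> exp (t\<^sup>2 * (s + r)\<^sup>2)"
    by simp
qed

lemma subgaussian_Tk:
  assumes "subgaussian f s"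
  shows "subgaussian (\<lambda>x. f ((T ^^ k) x)) s"
  unfolding subgaussian_def
proof (intro conjI allI)
  have f: "ebdd f"
    by (rule subgaussian_ebdd[OF assms])
  then show "ebdd (\<lambda>x. f ((T ^^ k) x))"
    by (rule ebdd_Tk)
  fix t
  have "(\<integral>x. exp (t * f ((T ^^ k) x)) \<partial>M) = (\<integral>x. exp (t * f x) \<partial>M)"
    by (rule integral_Tk[of "\<lambda>x. exp (t * f x)"]) (intro ebdd_meas ebdd_intros f)
  then show "(\<integral>x. exp (t * f ((T ^^ k) x)) \<partial>M) \<le> exp (t\<^sup>2 * s\<^sup>2)"
    using subgaussianD[OF assms] by simp
qed

text \<open>Azuma's inequality for the stationary martingale with increments \<open>h \<circ> T\<^sup>i\<^sup>l\<close>.\<close>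

lemma subgaussian_orbit_sum:
  assumes h: "ebdd h" "AE x in M. \<bar>h x\<bar> \<le> c" "(\<lambda>x. h ((V ^^ l) x)) \<in> borel_measurable F"
    and orth: "\<And>u. u \<in> borel_measurable F \<Longrightarrow> ebdd u \<Longrightarrow> (\<integral>x. u x * h x \<partial>M) = 0"
  shows "subgaussian (\<lambda>x. \<Sum>i<q. h ((T ^^ (i * l)) x)) (c * sqrt (real q))"
  unfolding subgaussian_def
proof (intro conjI allI)
  show "ebdd (\<lambda>x. \<Sum>i<q. h ((T ^^ (i * l)) x))"
    by (intro ebdd_intros h)
  fix t
  let ?K = "exp (t\<^sup>2 * c\<^sup>2)"
  have "(\<integral>x. exp (t * (\<Sum>i<q. h ((T ^^ (i * l)) x))) \<partial>M) = (\<integral>x. (\<Prod>i<q. exp (t * h ((T ^^ (i * l)) x))) \<partial>M)"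
    by (simp add: sum_distrib_left exp_sum)
  also have "\<dots> \<le> ?K ^ q"
  proof (rule orbit_prod_le)
    show "ebdd (\<lambda>x. exp (t * h x))"
      by (intro ebdd_intros h)
    show "(\<lambda>x. exp (t * h ((V ^^ l) x))) \<in> borel_measurable F"
      using h(3) by simp
    fix u :: "'a \<Rightarrow> real"
    assume u: "u \<in> borel_measurable F" "ebdd u" "\<And>x. 0 \<le> u x"
    have pt: "AE x in M. u x * exp (t * h x) \<le> u x * (t * h x) + u x * ?K"
      using h(2)
    proof eventually_elim
      case (elim x)
      have "(h x)\<^sup>2 \<le> c\<^sup>2"
        using power_mono[OF elim, of 2] by simp
      then have "exp ((t * h x)\<^sup>2) \<le> ?K"
        by (simp add: power_mult_distrib mult_left_mono)
      then have "exp (t * h x) \<le> t * h x + ?K"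
        using exp_le_self_plus_exp_square[of "t * h x"] by linarith
      then show ?case
        using u(3)[of x] by (metis distrib_left mult_left_mono)
    qed
    have "(\<integral>x. u x * exp (t * h x) \<partial>M) \<le> (\<integral>x. u x * (t * h x) + u x * ?K \<partial>M)"
      by (rule integral_mono_AE[OF _ _ pt]) (intro ebdd_integrable ebdd_intros h u)+
    also have "\<dots> = (\<integral>x. u x * (t * h x) \<partial>M) + (\<integral>x. u x * ?K \<partial>M)"
      by (intro Bochner_Integration.integral_add ebdd_integrable ebdd_intros h u)
    also have "(\<integral>x. u x * (t * h x) \<partial>M) = t * (\<integral>x. u x * h x \<partial>M)"
      by (simp add: mult.left_commute)
    also have "\<dots> = 0"
      using orth u by simp
    finally show "(\<integral>x. u x * exp (t * h x) \<partial>M) \<le> ?K * (\<integral>x. u x \<partial>M)"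
      by (simp add: mult.commute)
  qed auto
  also have "?K ^ q = exp (t\<^sup>2 * (c * sqrt (real q))\<^sup>2)"
    by (simp add: exp_of_nat_mult[symmetric] power_mult_distrib mult_ac)
  finally show "(\<integral>x. exp (t * (\<Sum>i<q. h ((T ^^ (i * l)) x))) \<partial>M) \<le> exp (t\<^sup>2 * (c * sqrt (real q))\<^sup>2)" .
qed

end

section \<open>Partial sums and their conditional expectations\<close>

text \<open>A stationary sequence \<open>X0 \<circ> T\<^sup>i\<close> generated by a bounded, centred and \<open>F\<close>-measurable \<open>X0\<close>.\<close>

locale bounded_adapted = invertible_system M F T V
  for M F :: "'a measure" and T V :: "'a \<Rightarrow> 'a" +
  fixes X0 :: "'a \<Rightarrow> real" and C :: real
  assumes X0_F: "X0 \<in> borel_measurable F"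
    and X0_le: "AE x in M. \<bar>X0 x\<bar> \<le> C"
    and X0_mean: "(\<integral>x. X0 x \<partial>M) = 0"
    and C_nonneg: "0 \<le> C"
begin

text \<open>The partial sums, their conditional expectations given \<open>F\<close>, and the \<open>L\<^sup>\<infinity>\<close>-norms of the latter as
  real numbers (they are finite, since \<open>X0\<close> is essentially bounded).\<close>

definition psum :: "nat \<Rightarrow> 'a \<Rightarrow> real" where
  "psum n x = (\<Sum>i<n. X0 ((T ^^ Suc i) x))"

definition drift :: "nat \<Rightarrow> 'a \<Rightarrow> real" where
  "drift n = real_cond_exp M F (psum n)"

definition drift_norm :: "nat \<Rightarrow> real" where
  "drift_norm n = enn2real (norm_Linf M (drift n))"

lemma X0_ebdd: "ebdd X0"
  by (rule ebddI[OF meas_F_M[OF X0_F] X0_le])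

lemma psum_ebdd: "ebdd (psum n)"
  unfolding psum_def by (intro ebdd_sum ebdd_Tk X0_ebdd)

lemma psum_add: "psum (i + j) x = psum i x + psum j ((T ^^ i) x)"
proof -
  have "psum (i + j) x = (\<Sum>k<i. X0 ((T ^^ Suc k) x)) + (\<Sum>k=i..<i + j. X0 ((T ^^ Suc k) x))"
    unfolding psum_def lessThan_atLeast0 by (rule sum.atLeastLessThan_concat[symmetric]) auto
  also have "(\<Sum>k=i..<i + j. X0 ((T ^^ Suc k) x)) = (\<Sum>k<j. X0 ((T ^^ Suc (k + i)) x))"
    using sum.shift_bounds_nat_ivl[of "\<lambda>k. X0 ((T ^^ Suc k) x)" 0 i j]
    by (simp add: lessThan_atLeast0 add.commute)
  also have "\<dots> = psum j ((T ^^ i) x)"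
    by (simp add: psum_def funpow_add)
  finally show ?thesis
    by (simp add: psum_def)
qed

lemma psum_mult: "psum (q * m) x = (\<Sum>i<q. psum m ((T ^^ (i * m)) x))"
proof (induction q)
  case (Suc q)
  then show ?case
    using psum_add[of "q * m" m x] by (simp add: add.commute)
qed (simp add: psum_def)

lemma abs_psum_le: "AE x in M. \<bar>psum n x\<bar> \<le> real n * C"
proof -
  have "AE x in M. \<forall>i\<in>{..<n}. \<bar>X0 ((T ^^ Suc i) x)\<bar> \<le> C"
    by (intro AE_finite_allI AE_Tk[OF X0_le]) auto
  then show ?thesis
  proof eventually_elim
    case (elim x)
    have "\<bar>psum n x\<bar> \<le> (\<Sum>i<n. \<bar>X0 ((T ^^ Suc i) x)\<bar>)"
      unfolding psum_def by (rule sum_abs)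
    also have "\<dots> \<le> (\<Sum>i<n. C)"
      using elim by (intro sum_mono) auto
    finally show ?case
      by simp
  qed
qed

lemma psum_Vk_F: "(\<lambda>x. psum n ((V ^^ n) x)) \<in> borel_measurable F"
proof -
  have "psum n ((V ^^ n) x) = (\<Sum>i<n. X0 ((V ^^ (n - Suc i)) x))" if "x \<in> space F" for x
    unfolding psum_def
  proof (intro sum.cong refl)
    fix i assume "i \<in> {..<n}"
    then show "X0 ((T ^^ Suc i) ((V ^^ n) x)) = X0 ((V ^^ (n - Suc i)) x)"
      using TkVk[of x "Suc i" "n - Suc i"] that by (simp add: space_F del: funpow.simps)
  qed
  moreover have "(\<lambda>x. \<Sum>i<n. X0 ((V ^^ (n - Suc i)) x)) \<in> borel_measurable F"
    using measurable_comp[OF Vk_meas_F X0_F] by (intro borel_measurable_sum) (simp add: o_def)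
  ultimately show ?thesis
    using measurable_cong[of F "\<lambda>x. psum n ((V ^^ n) x)" "\<lambda>x. \<Sum>i<n. X0 ((V ^^ (n - Suc i)) x)" borel] by simp
qed

lemma drift_F: "drift n \<in> borel_measurable F"
  by (simp add: drift_def)

lemma drift_Vk_F: "(\<lambda>x. drift n ((V ^^ k) x)) \<in> borel_measurable F"
  using measurable_comp[OF Vk_meas_F drift_F] by (simp add: o_def)

lemma drift_ebdd: "ebdd (drift n)"
  unfolding drift_def by (intro ebdd_cond_exp psum_ebdd)

lemma integral_drift:
  "ebdd u \<Longrightarrow> u \<in> borel_measurable F \<Longrightarrow> (\<integral>x. u x * drift n x \<partial>M) = (\<integral>x. u x * psum n x \<partial>M)"
  unfolding drift_def by (intro integral_mult_cond_exp psum_ebdd)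

lemma integral_drift_Tk:
  assumes u: "ebdd u" "u \<in> borel_measurable F"
  shows "(\<integral>x. u x * drift n ((T ^^ k) x) \<partial>M) = (\<integral>x. u x * psum n ((T ^^ k) x) \<partial>M)"
proof -
  have *: "(\<integral>x. u x * f ((T ^^ k) x) \<partial>M) = (\<integral>x. u ((V ^^ k) x) * f x \<partial>M)" if "ebdd f" for f
  proof -
    have "(\<integral>x. u x * f ((T ^^ k) x) \<partial>M) = (\<integral>x. (\<lambda>x. u ((V ^^ k) x) * f x) ((T ^^ k) x) \<partial>M)"
      by (intro Bochner_Integration.integral_cong refl) (simp add: VkTk)
    also have "\<dots> = (\<integral>x. u ((V ^^ k) x) * f x \<partial>M)"
      by (intro integral_Tk ebdd_meas ebdd_intros that u)
    finally show ?thesis .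
  qed
  have "(\<lambda>x. u ((V ^^ k) x)) \<in> borel_measurable F"
    using measurable_comp[OF Vk_meas_F u(2)] by (simp add: o_def)
  then show ?thesis
    using * drift_ebdd psum_ebdd integral_drift[of "\<lambda>x. u ((V ^^ k) x)"] u by (simp add: ebdd_Vk)
qed

lemma abs_drift_le: "AE x in M. \<bar>drift n x\<bar> \<le> drift_norm n"
  unfolding drift_norm_def by (rule norm_Linf_ebdd[OF drift_ebdd])

lemma ennreal_drift_norm: "ennreal (drift_norm n) = norm_Linf M (drift n)"
  unfolding drift_norm_def using norm_Linf_ebdd(1)[OF drift_ebdd] by simp

lemma drift_norm_le:
  assumes "0 \<le> K" "AE x in M. \<bar>drift n x\<bar> \<le> K"
  shows "drift_norm n \<le> K"
proof -
  have "norm_Linf M (drift n) \<le> ennreal K"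
    unfolding norm_Linf_def using assms(2) ebdd_meas[OF drift_ebdd]
    by (intro esssup_I) (auto intro: ennreal_leI)
  then show ?thesis
    unfolding drift_norm_def using enn2real_mono[of _ "ennreal K"] assms(1) by simp
qed

lemma drift_norm_nonneg: "0 \<le> drift_norm n"
  by (simp add: drift_norm_def)

lemma drift_norm_0: "drift_norm 0 = 0"
proof -
  have "AE x in M. \<bar>drift 0 x\<bar> \<le> 0"
    unfolding drift_def
    by (intro abs_real_cond_exp_le ebdd_integrable psum_ebdd) (simp add: psum_def)
  then show ?thesis
    using drift_norm_le[of 0 0] drift_norm_nonneg[of 0] by simp
qed

text \<open>The second part of the sum is handled by the tower property: conditionally on \<open>F\<close>, the function
  \<open>psum j \<circ> T\<^sup>i\<close> may be replaced by \<open>drift j \<circ> T\<^sup>i\<close>.\<close>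

lemma drift_norm_subadd: "drift_norm (i + j) \<le> drift_norm i + drift_norm j"
proof (rule drift_norm_le)
  show "0 \<le> drift_norm i + drift_norm j"
    by (simp add: drift_norm_nonneg)
  define G where "G = real_cond_exp M F (\<lambda>x. drift j ((T ^^ i) x))"
  have G: "ebdd G" "G \<in> borel_measurable F"
    by (auto simp: G_def intro!: ebdd_cond_exp ebdd_Tk drift_ebdd)
  have G_le: "AE x in M. \<bar>G x\<bar> \<le> drift_norm j"
    unfolding G_def
    by (intro abs_real_cond_exp_le ebdd_integrable ebdd_Tk drift_ebdd AE_Tk abs_drift_le)
  have "AE x in M. drift (i + j) x = drift i x + G x"
    unfolding drift_def[of "i + j"]
  proof (rule real_cond_exp_charact)
    show "integrable M (psum (i + j))" "integrable M (\<lambda>x. drift i x + G x)"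
      by (intro ebdd_integrable ebdd_intros psum_ebdd drift_ebdd G)+
    show "(\<lambda>x. drift i x + G x) \<in> borel_measurable F"
      using G drift_F by simp
    fix A assume A: "A \<in> sets F"
    let ?u = "indicat_real A"
    have u1: "?u \<in> borel_measurable F"
      using A by (rule borel_measurable_indicator)
    have "ebdd ?u"
      by (rule ebddI[of _ 1]) (auto intro!: meas_F_M u1 simp: indicator_def)
    note u = u1 this
    have "(\<integral>x. ?u x * psum (i + j) x \<partial>M) = (\<integral>x. ?u x * psum i x + ?u x * psum j ((T ^^ i) x) \<partial>M)"
      by (simp add: psum_add distrib_left)
    also have "\<dots> = (\<integral>x. ?u x * psum i x \<partial>M) + (\<integral>x. ?u x * psum j ((T ^^ i) x) \<partial>M)"
      by (intro Bochner_Integration.integral_add ebdd_integrable ebdd_intros psum_ebdd u)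
    also have "(\<integral>x. ?u x * psum i x \<partial>M) = (\<integral>x. ?u x * drift i x \<partial>M)"
      using u by (simp add: integral_drift)
    also have "(\<integral>x. ?u x * psum j ((T ^^ i) x) \<partial>M) = (\<integral>x. ?u x * drift j ((T ^^ i) x) \<partial>M)"
      using u by (simp add: integral_drift_Tk)
    also have "\<dots> = (\<integral>x. ?u x * G x \<partial>M)"
      unfolding G_def using u by (intro integral_mult_cond_exp[symmetric] ebdd_Tk drift_ebdd)
    also have "(\<integral>x. ?u x * drift i x \<partial>M) + (\<integral>x. ?u x * G x \<partial>M) = (\<integral>x. ?u x * drift i x + ?u x * G x \<partial>M)"
      by (intro Bochner_Integration.integral_add[symmetric] ebdd_integrable ebdd_intros drift_ebdd u G)
    finally show "(\<integral>x\<in>A. psum (i + j) x \<partial>M) = (\<integral>x\<in>A. (drift i x + G x) \<partial>M)"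
      by (simp add: set_lebesgue_integral_def distrib_left)
  qed
  then show "AE x in M. \<bar>drift (i + j) x\<bar> \<le> drift_norm i + drift_norm j"
    using G_le abs_drift_le[of i] by eventually_elim linarith
qed

section \<open>The sums of the block drifts are subgaussian\<close>

text \<open>The orbit sum of \<open>drift m\<close> over steps of length \<open>m\<close> is what remains of \<open>S\<^sub>q\<^sub>m\<close> after its
  martingale part for the blocks of length \<open>m\<close> is removed.\<close>

definition drift_sum :: "nat \<Rightarrow> nat \<Rightarrow> 'a \<Rightarrow> real" where
  "drift_sum m q x = (\<Sum>i<q. drift m ((T ^^ (i * m)) x))"

lemma drift_sum_ebdd: "ebdd (drift_sum m q)"
  unfolding drift_sum_def by (intro ebdd_sum ebdd_Tk drift_ebdd)

lemma drift_sum_add: "drift_sum m (p + q) x = drift_sum m p x + drift_sum m q ((T ^^ (p * m)) x)"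
proof (induction q)
  case (Suc q)
  have "(T ^^ ((p + q) * m)) x = (T ^^ (q * m)) ((T ^^ (p * m)) x)"
    by (simp add: add_mult_distrib add.commute[of "p * m"] funpow_add)
  then show ?case
    using Suc by (simp add: drift_sum_def)
qed (simp add: drift_sum_def)

text \<open>The error made when the drifts of two neighbouring blocks of length \<open>m\<close> are replaced by the
  drift of the joint block. It is \<open>drift m \<circ> T\<^sup>m\<close> minus its conditional expectation given \<open>F\<close>, hence
  orthogonal to the bounded \<open>F\<close>-measurable functions.\<close>

definition pair_diff :: "nat \<Rightarrow> 'a \<Rightarrow> real" where
  "pair_diff m x = drift m x + drift m ((T ^^ m) x) - drift (2 * m) x"

lemma drift_sum_double:
  "drift_sum m (2 * q) x = drift_sum (2 * m) q x + (\<Sum>i<q. pair_diff m ((T ^^ (i * (2 * m))) x))"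
proof (induction q)
  case (Suc q)
  have "drift_sum m (2 * Suc q) x = drift_sum m (2 * q) x
      + drift m ((T ^^ (q * (2 * m))) x) + drift m ((T ^^ m) ((T ^^ (q * (2 * m))) x))"
    unfolding drift_sum_def by (simp add: mult_ac flip: funpow_add[THEN fun_cong, unfolded comp_apply])
  then show ?case
    using Suc by (simp add: pair_diff_def drift_sum_def)
qed (simp add: drift_sum_def)

lemma subgaussian_pair_diff:
  "subgaussian (\<lambda>x. \<Sum>i<q. pair_diff m ((T ^^ (i * (2 * m))) x)) (4 * drift_norm m * sqrt (real q))"
proof (rule subgaussian_orbit_sum)
  show "ebdd (pair_diff m)"
    unfolding pair_diff_def by (intro ebdd_intros drift_ebdd)
  have le: "drift_norm (2 * m) \<le> 2 * drift_norm m"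
    using drift_norm_subadd[of m m] by (simp only: mult_2)
  show "AE x in M. \<bar>pair_diff m x\<bar> \<le> 4 * drift_norm m"
    using abs_drift_le[of m] AE_Tk[OF abs_drift_le[of m], of m] abs_drift_le[of "2 * m"]
    unfolding pair_diff_def
  proof eventually_elim
    case (elim x)
    then show ?case
      using le by linarith
  qed
  have "drift m ((T ^^ m) ((V ^^ (2 * m)) x)) = drift m ((V ^^ m) x)" if "x \<in> space F" for x
    using TkVk[of x m m] that by (simp only: space_F mult_2)
  then have "pair_diff m ((V ^^ (2 * m)) x) =
      drift m ((V ^^ (2 * m)) x) + drift m ((V ^^ m) x) - drift (2 * m) ((V ^^ (2 * m)) x)" if "x \<in> space F" for x
    using that by (simp add: pair_diff_def)
  moreover have "(\<lambda>x. drift m ((V ^^ (2 * m)) x) + drift m ((V ^^ m) x) - drift (2 * m) ((V ^^ (2 * m)) x))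
      \<in> borel_measurable F"
    by (intro borel_measurable_add borel_measurable_diff drift_Vk_F)
  ultimately show "(\<lambda>x. pair_diff m ((V ^^ (2 * m)) x)) \<in> borel_measurable F"
    by (simp cong: measurable_cong)
  fix u assume u: "u \<in> borel_measurable F" "ebdd u"
  have "(\<integral>x. u x * pair_diff m x \<partial>M)
      = (\<integral>x. (u x * drift m x + u x * drift m ((T ^^ m) x)) - u x * drift (2 * m) x \<partial>M)"
    by (simp add: pair_diff_def algebra_simps)
  also have "\<dots> = (\<integral>x. u x * drift m x + u x * drift m ((T ^^ m) x) \<partial>M) - (\<integral>x. u x * drift (2 * m) x \<partial>M)"
    by (intro Bochner_Integration.integral_diff ebdd_integrable ebdd_intros drift_ebdd u)
  also have "(\<integral>x. u x * drift m x + u x * drift m ((T ^^ m) x) \<partial>M)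
      = (\<integral>x. u x * drift m x \<partial>M) + (\<integral>x. u x * drift m ((T ^^ m) x) \<partial>M)"
    by (intro Bochner_Integration.integral_add ebdd_integrable ebdd_intros drift_ebdd u)
  also have "\<dots> = (\<integral>x. u x * psum m x \<partial>M) + (\<integral>x. u x * psum m ((T ^^ m) x) \<partial>M)"
    using u by (simp add: integral_drift integral_drift_Tk)
  also have "\<dots> = (\<integral>x. u x * psum m x + u x * psum m ((T ^^ m) x) \<partial>M)"
    by (intro Bochner_Integration.integral_add[symmetric] ebdd_integrable ebdd_intros psum_ebdd u)
  also have "\<dots> = (\<integral>x. u x * psum (2 * m) x \<partial>M)"
    unfolding mult_2 psum_add by (simp add: distrib_left)
  also have "\<dots> = (\<integral>x. u x * drift (2 * m) x \<partial>M)"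
    using u by (simp add: integral_drift)
  finally show "(\<integral>x. u x * pair_diff m x \<partial>M) = 0"
    by simp
qed

lemma subgaussian_drift: "subgaussian (drift m) (drift_norm m)"
proof -
  have pt: "AE x in M. exp (t * drift m x) \<le> t * drift m x + exp (t\<^sup>2 * (drift_norm m)\<^sup>2)" for t
    using abs_drift_le[of m]
  proof eventually_elim
    case (elim x)
    have "(drift m x)\<^sup>2 \<le> (drift_norm m)\<^sup>2"
      using power_mono[OF elim, of 2] by simp
    then have "exp ((t * drift m x)\<^sup>2) \<le> exp (t\<^sup>2 * (drift_norm m)\<^sup>2)"
      by (simp add: power_mult_distrib mult_left_mono)
    then show ?case
      using exp_le_self_plus_exp_square[of "t * drift m x"] by linarith
  qed
  have "(\<integral>x. psum m x \<partial>M) = (\<Sum>i<m. \<integral>x. X0 ((T ^^ Suc i) x) \<partial>M)"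
    unfolding psum_def by (intro Bochner_Integration.integral_sum ebdd_integrable ebdd_Tk X0_ebdd)
  also have "\<dots> = 0"
    by (simp only: integral_Tk[OF ebdd_meas[OF X0_ebdd]] X0_mean sum.neutral_const)
  finally have mean: "(\<integral>x. drift m x \<partial>M) = 0"
    using integral_drift[of "\<lambda>_. 1" m] by simp
  have "(\<integral>x. exp (t * drift m x) \<partial>M) \<le> (\<integral>x. t * drift m x + exp (t\<^sup>2 * (drift_norm m)\<^sup>2) \<partial>M)" for t
    by (rule integral_mono_AE[OF _ _ pt]) (intro ebdd_integrable ebdd_intros drift_ebdd)+
  also have "\<dots> t = t * (\<integral>x. drift m x \<partial>M) + exp (t\<^sup>2 * (drift_norm m)\<^sup>2)" for t
    using ebdd_integrable[OF drift_ebdd] by (simp add: prob_space)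
  finally show ?thesis
    by (simp add: subgaussian_def drift_ebdd mean)
qed

text \<open>At each level the number of blocks is halved and their length doubled, until a single block
  remains; the term \<open>k\<close> of the sum comes from the martingale of pairs of blocks of length \<open>m 2\<^sup>k\<close>.\<close>

lemma subgaussian_drift_sum_dyadic:
  "subgaussian (drift_sum m (2 ^ r))
    (4 * sqrt (2 ^ r) * (\<Sum>k\<le>r. (1 / sqrt 2) ^ k * drift_norm (m * 2 ^ k)))"
proof (induction r arbitrary: m)
  case 0
  have "drift_sum m (2 ^ 0) = drift m"
    by (simp add: drift_sum_def fun_eq_iff)
  then show ?case
    using subgaussian_mono[OF subgaussian_drift[of m], of "4 * drift_norm m"] by (simp add: drift_norm_nonneg)
next
  case (Suc r)
  let ?K = "\<lambda>m r. \<Sum>k\<le>r. (1 / sqrt 2) ^ k * drift_norm (m * 2 ^ k)"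
  have K_nonneg: "0 \<le> ?K m r" for m r
    by (intro sum_nonneg mult_nonneg_nonneg) (auto simp: drift_norm_nonneg)
  have "?K m (Suc r) = drift_norm m + 1 / sqrt 2 * ?K (2 * m) r"
    by (simp only: sum.atMost_Suc_shift) (simp add: sum_distrib_left mult_ac)
  then have "4 * sqrt (2 ^ Suc r) * ?K m (Suc r) =
      4 * sqrt (2 ^ r) * ?K (2 * m) r + 4 * drift_norm m * (sqrt 2 * sqrt (2 ^ r))"
    by (simp add: real_sqrt_mult distrib_left)
  moreover have "4 * drift_norm m * sqrt (2 ^ r) \<le> 4 * drift_norm m * (sqrt 2 * sqrt (2 ^ r))"
    by (intro mult_left_mono) (auto simp: drift_norm_nonneg)
  ultimately have le: "4 * sqrt (2 ^ r) * ?K (2 * m) r + 4 * drift_norm m * sqrt (2 ^ r) \<le> 4 * sqrt (2 ^ Suc r) * ?K m (Suc r)"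
    by linarith
  have "subgaussian (\<lambda>x. drift_sum (2 * m) (2 ^ r) x + (\<Sum>i<2 ^ r. pair_diff m ((T ^^ (i * (2 * m))) x)))
      (4 * sqrt (2 ^ r) * ?K (2 * m) r + 4 * drift_norm m * sqrt (real (2 ^ r)))"
    by (intro subgaussian_add[OF Suc _ subgaussian_pair_diff] mult_nonneg_nonneg K_nonneg)
      (auto simp: drift_norm_nonneg)
  then have "subgaussian (drift_sum m (2 ^ Suc r)) (4 * sqrt (2 ^ r) * ?K (2 * m) r + 4 * drift_norm m * sqrt (2 ^ r))"
    unfolding power_Suc drift_sum_double[symmetric] by simp
  moreover have "0 \<le> 4 * sqrt (2 ^ r) * ?K (2 * m) r + 4 * drift_norm m * sqrt (2 ^ r)"
    by (intro add_nonneg_nonneg mult_nonneg_nonneg K_nonneg) (auto simp: drift_norm_nonneg)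
  ultimately show ?case
    using le by (rule subgaussian_mono)
qed

lemma subgaussian_drift_sum:
  assumes G: "\<And>J. (\<Sum>j = 1..J. drift_norm (m * j) / real j powr (3 / 2)) \<le> G"
  shows "subgaussian (drift_sum m q) (64 * G * sqrt (real q))"
proof (induction q rule: less_induct)
  case (less q)
  have G0: "0 \<le> G"
    using G[of 0] by simp
  show ?case
  proof (cases "q = 0")
    case True
    have "drift_sum m 0 = (\<lambda>x. 0)"
      by (simp add: drift_sum_def fun_eq_iff)
    then show ?thesis
      using True by (simp add: subgaussian_def prob_space)
  next
    case False
    \<comment> \<open>split off the largest power of two; the rest has length at most \<open>q / 2\<close>\<close>
    obtain r where r: "2 ^ r \<le> q" "q < 2 ^ Suc r"
      using ex_power_ivl1[of 2 q] False by auto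
    define p where "p = q - 2 ^ r"
    have q: "q = 2 ^ r + p" "p < 2 ^ r" "p < q"
      using r by (auto simp: p_def)
    have "(\<Sum>k\<le>r. (1 / sqrt 2) ^ k * drift_norm (m * 2 ^ k)) \<le> 4 * (\<Sum>j = 1..2 ^ r. drift_norm (m * j) / real j powr (3 / 2))"
      by (rule dyadic_sum_le)
        (auto simp: drift_norm_nonneg drift_norm_0 distrib_left intro: drift_norm_subadd)
    also have "\<dots> \<le> 4 * G"
      by (intro mult_left_mono G) auto
    finally have "4 * sqrt (2 ^ r) * (\<Sum>k\<le>r. (1 / sqrt 2) ^ k * drift_norm (m * 2 ^ k)) \<le> 4 * sqrt (2 ^ r) * (4 * G)"
      by (intro mult_left_mono) auto
    then have 1: "subgaussian (drift_sum m (2 ^ r)) (16 * G * sqrt (2 ^ r))"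
      by (intro subgaussian_mono[OF subgaussian_drift_sum_dyadic] mult_nonneg_nonneg sum_nonneg)
        (auto simp: drift_norm_nonneg mult_ac)
    have "subgaussian (\<lambda>x. drift_sum m (2 ^ r) x + drift_sum m p ((T ^^ (2 ^ r * m)) x))
        (16 * G * sqrt (2 ^ r) + 64 * G * sqrt (real p))"
      using G0 by (intro subgaussian_add[OF 1 _ subgaussian_Tk[OF less[OF q(3)]]]) auto
    then have 2: "subgaussian (drift_sum m q) (16 * G * sqrt (2 ^ r) + 64 * G * sqrt (real p))"
      unfolding q(1) drift_sum_add[symmetric] by simp
    have "real p \<le> 9 / 16 * real q"
      using q(1,2) by linarith
    then have "sqrt (real p) \<le> sqrt (9 / 16 * real q)"
      by (rule real_sqrt_le_mono)
    also have "\<dots> = 3 / 4 * sqrt (real q)"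
      by (simp add: real_sqrt_mult real_sqrt_divide)
    finally have "64 * G * sqrt (real p) \<le> 64 * G * (3 / 4 * sqrt (real q))"
      using G0 by (intro mult_left_mono) auto
    moreover have "2 ^ r \<le> real q"
      using r(1) by (metis of_nat_le_iff of_nat_numeral of_nat_power)
    then have "16 * G * sqrt (2 ^ r) \<le> 16 * G * sqrt (real q)"
      using G0 by (intro mult_left_mono real_sqrt_le_mono) auto
    ultimately have "16 * G * sqrt (2 ^ r) + 64 * G * sqrt (real p) \<le> 64 * G * sqrt (real q)"
      by (simp add: algebra_simps)
    then show ?thesis
      using G0 by (intro subgaussian_mono[OF 2]) auto
  qed
qed

end

section \<open>The moment generating function of the partial sums\<close>

context bounded_adapted
begin

text \<open>The martingale difference of a single block of length \<open>m\<close>, and the martingale it generates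
  along the first \<open>q\<close> blocks.\<close>

definition block_diff :: "nat \<Rightarrow> 'a \<Rightarrow> real" where
  "block_diff m x = psum m x - drift m x"

definition mart_sum :: "nat \<Rightarrow> nat \<Rightarrow> 'a \<Rightarrow> real" where
  "mart_sum m q x = (\<Sum>i<q. block_diff m ((T ^^ (i * m)) x))"

lemma psum_decomp: "psum (q * m) x = mart_sum m q x + drift_sum m q x"
  unfolding psum_mult mart_sum_def drift_sum_def block_diff_def by (simp flip: sum.distrib)

lemma block_diff_ebdd: "ebdd (block_diff m)"
  unfolding block_diff_def by (intro ebdd_intros psum_ebdd drift_ebdd)

lemma mart_sum_ebdd: "ebdd (mart_sum m q)"
  unfolding mart_sum_def by (intro ebdd_sum ebdd_Tk block_diff_ebdd)

lemma abs_block_diff_le: "AE x in M. \<bar>block_diff m x\<bar> \<le> 2 * real m * C"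
proof -
  have "AE x in M. \<bar>drift m x\<bar> \<le> real m * C"
    unfolding drift_def by (intro abs_real_cond_exp_le ebdd_integrable psum_ebdd abs_psum_le)
  with abs_psum_le[of m] show ?thesis
    unfolding block_diff_def by eventually_elim linarith
qed

lemma block_diff_Vk_F: "(\<lambda>x. block_diff m ((V ^^ m) x)) \<in> borel_measurable F"
  unfolding block_diff_def by (intro borel_measurable_diff psum_Vk_F drift_Vk_F)

lemma integral_block_diff:
  assumes "u \<in> borel_measurable F" "ebdd u"
  shows "(\<integral>x. u x * block_diff m x \<partial>M) = 0"
proof -
  have "(\<integral>x. u x * block_diff m x \<partial>M) = (\<integral>x. u x * psum m x - u x * drift m x \<partial>M)"
    by (simp add: block_diff_def right_diff_distrib)
  also have "\<dots> = (\<integral>x. u x * psum m x \<partial>M) - (\<integral>x. u x * drift m x \<partial>M)"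
    by (intro Bochner_Integration.integral_diff ebdd_integrable ebdd_intros psum_ebdd drift_ebdd assms)
  finally show ?thesis
    using assms by (simp add: integral_drift)
qed

text \<open>A block length \<open>m\<close> is \<open>(v, e)\<close>-good if, up to a relative error \<open>e\<close>, the conditional mean of
  \<open>S\<^sub>m\<close> is negligible at scale \<open>m\<^sup>1\<^sup>/\<^sup>2\<close>, also summed along the multiples of \<open>m\<close>, and the conditional
  second moment is \<open>m v\<close>.\<close>

definition good_block :: "real \<Rightarrow> real \<Rightarrow> nat \<Rightarrow> bool" where
  "good_block v e m \<longleftrightarrow> 1 \<le> m \<and>
     (\<forall>J. (\<Sum>j = 1..J. drift_norm (m * j) / real j powr (3 / 2)) \<le> e * sqrt (real m)) \<and>
     (drift_norm m)\<^sup>2 \<le> e * real m \<and>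
     (AE x in M. \<bar>real_cond_exp M F (\<lambda>x. (psum m x)\<^sup>2) x - real m * v\<bar> \<le> e * real m)"

lemma integral_block_diff_square:
  assumes good: "good_block v e m"
    and u: "u \<in> borel_measurable F" "ebdd u" "\<And>x. 0 \<le> u x"
  shows "\<bar>(\<integral>x. u x * (block_diff m x)\<^sup>2 \<partial>M) - real m * v * (\<integral>x. u x \<partial>M)\<bar> \<le> 2 * e * real m * (\<integral>x. u x \<partial>M)"
proof -
  let ?cs = "real_cond_exp M F (\<lambda>x. (psum m x)\<^sup>2)"
  have cs: "AE x in M. \<bar>?cs x - real m * v\<bar> \<le> e * real m" "ebdd ?cs"
    using good by (auto simp: good_block_def intro!: ebdd_cond_exp ebdd_power psum_ebdd)
  have ud: "ebdd (\<lambda>x. u x * drift m x)" "(\<lambda>x. u x * drift m x) \<in> borel_measurable F"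
    using u drift_F by (auto intro!: ebdd_mult drift_ebdd)
  have "(\<integral>x. u x * (block_diff m x)\<^sup>2 \<partial>M)
      = (\<integral>x. (u x * (psum m x)\<^sup>2 - 2 * (u x * drift m x * psum m x)) + u x * drift m x * drift m x \<partial>M)"
    by (simp add: block_diff_def power2_eq_square algebra_simps)
  also have "\<dots> = (\<integral>x. u x * (psum m x)\<^sup>2 - 2 * (u x * drift m x * psum m x) \<partial>M)
      + (\<integral>x. u x * drift m x * drift m x \<partial>M)"
    by (intro Bochner_Integration.integral_add ebdd_integrable ebdd_intros psum_ebdd drift_ebdd u)
  also have "(\<integral>x. u x * (psum m x)\<^sup>2 - 2 * (u x * drift m x * psum m x) \<partial>M)
      = (\<integral>x. u x * (psum m x)\<^sup>2 \<partial>M) - (\<integral>x. 2 * (u x * drift m x * psum m x) \<partial>M)"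
    by (intro Bochner_Integration.integral_diff ebdd_integrable ebdd_intros psum_ebdd drift_ebdd u)
  also have "(\<integral>x. 2 * (u x * drift m x * psum m x) \<partial>M) = 2 * (\<integral>x. u x * drift m x * drift m x \<partial>M)"
    using integral_drift[OF ud] by simp
  also have "(\<integral>x. u x * (psum m x)\<^sup>2 \<partial>M) = (\<integral>x. u x * ?cs x \<partial>M)"
    using u by (intro integral_mult_cond_exp[symmetric] ebdd_power psum_ebdd)
  finally have eq: "(\<integral>x. u x * (block_diff m x)\<^sup>2 \<partial>M)
      = (\<integral>x. u x * ?cs x \<partial>M) - (\<integral>x. u x * drift m x * drift m x \<partial>M)"
    by simp
  have 1: "(\<integral>x. u x * drift m x * drift m x \<partial>M) \<le> (\<integral>x. e * real m * u x \<partial>M)"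
  proof (rule integral_mono_AE)
    show "AE x in M. u x * drift m x * drift m x \<le> e * real m * u x"
      using abs_drift_le[of m]
    proof eventually_elim
      case (elim x)
      have "drift m x * drift m x \<le> (drift_norm m)\<^sup>2"
        using power_mono[OF elim, of 2] by (simp add: power2_eq_square)
      also have "\<dots> \<le> e * real m"
        using good by (simp add: good_block_def)
      finally show ?case
        using mult_left_mono[of "drift m x * drift m x" "e * real m" "u x"] u(3)[of x] by (simp add: mult_ac)
    qed
  qed (intro ebdd_integrable ebdd_intros drift_ebdd u)+
  have 2: "0 \<le> (\<integral>x. u x * drift m x * drift m x \<partial>M)"
    using u(3) by (intro Bochner_Integration.integral_nonneg) (simp add: mult.assoc)
  have 3: "(\<integral>x. u x * ?cs x \<partial>M) \<le> (\<integral>x. (real m * v + e * real m) * u x \<partial>M)"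
  proof (rule integral_mono_AE)
    show "AE x in M. u x * ?cs x \<le> (real m * v + e * real m) * u x"
      using cs(1)
    proof eventually_elim
      case (elim x)
      then show ?case
        using mult_left_mono[of "?cs x" "real m * v + e * real m" "u x"] u(3)[of x] by (simp add: mult_ac)
    qed
  qed (intro ebdd_integrable ebdd_intros cs u)+
  have 4: "(\<integral>x. (real m * v - e * real m) * u x \<partial>M) \<le> (\<integral>x. u x * ?cs x \<partial>M)"
  proof (rule integral_mono_AE)
    show "AE x in M. (real m * v - e * real m) * u x \<le> u x * ?cs x"
      using cs(1)
    proof eventually_elim
      case (elim x)
      then show ?case
        using mult_left_mono[of "real m * v - e * real m" "?cs x" "u x"] u(3)[of x] by (simp add: mult_ac)
    qed
  qed (intro ebdd_integrable ebdd_intros cs u)+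
  show ?thesis
    using 1 2 3 4 unfolding eq integral_mult_right_zero abs_le_iff by (simp add: algebra_simps)
qed

text \<open>The conditional moment generating function of one block; the cubic terms are negligible since
  \<open>m\<close> stays fixed while \<open>t\<close> tends to \<open>0\<close>.\<close>

lemma integral_exp_block_diff:
  assumes good: "good_block v e m" and t: "\<bar>t\<bar> * (2 * real m * C) \<le> 1"
    and u: "u \<in> borel_measurable F" "ebdd u" "\<And>x. 0 \<le> u x"
  shows "(\<integral>x. u x * exp (t * block_diff m x) \<partial>M)
      \<le> (1 + (t\<^sup>2 * (real m * (v + 2 * e)) / 2 + \<bar>t\<bar> ^ 3 * (2 * real m * C) ^ 3)) * (\<integral>x. u x \<partial>M)"
    and "(1 + (t\<^sup>2 * (real m * (v - 2 * e)) / 2 - \<bar>t\<bar> ^ 3 * (2 * real m * C) ^ 3)) * (\<integral>x. u x \<partial>M)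
      \<le> (\<integral>x. u x * exp (t * block_diff m x) \<partial>M)"
proof -
  let ?D = "block_diff m" and ?B = "\<bar>t\<bar> ^ 3 * (2 * real m * C) ^ 3"
  note sq = integral_block_diff_square[OF good u]
  have pt: "AE x in M. \<bar>exp (t * ?D x) - (1 + t * ?D x + (t * ?D x)\<^sup>2 / 2)\<bar> \<le> ?B"
    using abs_block_diff_le[of m]
  proof eventually_elim
    case (elim x)
    have le: "\<bar>t * ?D x\<bar> \<le> \<bar>t\<bar> * (2 * real m * C)"
      unfolding abs_mult by (intro mult_left_mono elim) auto
    then have "\<bar>t * ?D x\<bar> \<le> 1"
      using t by linarith
    moreover have "\<bar>t * ?D x\<bar> ^ 3 \<le> (\<bar>t\<bar> * (2 * real m * C)) ^ 3"
      by (intro power_mono le) auto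
    ultimately show ?case
      using exp_second_order_bound[of "t * ?D x"] by (simp add: power_mult_distrib)
  qed
  have quad: "(\<integral>x. u x * c + t * (u x * ?D x) + t\<^sup>2 / 2 * (u x * (?D x)\<^sup>2) \<partial>M)
      = c * (\<integral>x. u x \<partial>M) + t\<^sup>2 / 2 * (\<integral>x. u x * (?D x)\<^sup>2 \<partial>M)" for c
  proof -
    have "(\<integral>x. u x * c + t * (u x * ?D x) + t\<^sup>2 / 2 * (u x * (?D x)\<^sup>2) \<partial>M)
        = (\<integral>x. u x * c + t * (u x * ?D x) \<partial>M) + (\<integral>x. t\<^sup>2 / 2 * (u x * (?D x)\<^sup>2) \<partial>M)"
      by (intro Bochner_Integration.integral_add ebdd_integrable ebdd_intros block_diff_ebdd u)
    also have "(\<integral>x. u x * c + t * (u x * ?D x) \<partial>M) = (\<integral>x. u x * c \<partial>M) + (\<integral>x. t * (u x * ?D x) \<partial>M)"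
      by (intro Bochner_Integration.integral_add ebdd_integrable ebdd_intros block_diff_ebdd u)
    finally show ?thesis
      using integral_block_diff[OF u(1,2), of m] by simp
  qed
  have "(\<integral>x. u x * exp (t * ?D x) \<partial>M)
      \<le> (\<integral>x. u x * (1 + ?B) + t * (u x * ?D x) + t\<^sup>2 / 2 * (u x * (?D x)\<^sup>2) \<partial>M)"
  proof (rule integral_mono_AE)
    show "AE x in M. u x * exp (t * ?D x) \<le> u x * (1 + ?B) + t * (u x * ?D x) + t\<^sup>2 / 2 * (u x * (?D x)\<^sup>2)"
      using pt
    proof eventually_elim
      case (elim x)
      then have "exp (t * ?D x) \<le> 1 + ?B + t * ?D x + (t * ?D x)\<^sup>2 / 2"
        by linarith
      from mult_left_mono[OF this u(3)[of x]] show ?case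
        by (simp add: algebra_simps power2_eq_square)
    qed
  qed (intro ebdd_integrable ebdd_intros block_diff_ebdd u)+
  also have "\<dots> = (1 + ?B) * (\<integral>x. u x \<partial>M) + t\<^sup>2 / 2 * (\<integral>x. u x * (?D x)\<^sup>2 \<partial>M)"
    by (rule quad)
  also have "\<dots> \<le> (1 + ?B) * (\<integral>x. u x \<partial>M) + t\<^sup>2 / 2 * ((real m * (v + 2 * e)) * (\<integral>x. u x \<partial>M))"
    using sq by (intro add_left_mono mult_left_mono) (auto simp: algebra_simps)
  finally show "(\<integral>x. u x * exp (t * ?D x) \<partial>M)
      \<le> (1 + (t\<^sup>2 * (real m * (v + 2 * e)) / 2 + ?B)) * (\<integral>x. u x \<partial>M)"
    by (simp add: field_simps)
  have "(1 + (t\<^sup>2 * (real m * (v - 2 * e)) / 2 - ?B)) * (\<integral>x. u x \<partial>M)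
      = (1 - ?B) * (\<integral>x. u x \<partial>M) + t\<^sup>2 / 2 * ((real m * (v - 2 * e)) * (\<integral>x. u x \<partial>M))"
    by (simp add: field_simps)
  also have "\<dots> \<le> (1 - ?B) * (\<integral>x. u x \<partial>M) + t\<^sup>2 / 2 * (\<integral>x. u x * (?D x)\<^sup>2 \<partial>M)"
    using sq by (intro add_left_mono mult_left_mono) (auto simp: algebra_simps)
  also have "\<dots> = (\<integral>x. u x * (1 - ?B) + t * (u x * ?D x) + t\<^sup>2 / 2 * (u x * (?D x)\<^sup>2) \<partial>M)"
    by (rule quad[symmetric])
  also have "\<dots> \<le> (\<integral>x. u x * exp (t * ?D x) \<partial>M)"
  proof (rule integral_mono_AE)
    show "AE x in M. u x * (1 - ?B) + t * (u x * ?D x) + t\<^sup>2 / 2 * (u x * (?D x)\<^sup>2) \<le> u x * exp (t * ?D x)"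
      using pt
    proof eventually_elim
      case (elim x)
      then have "1 - ?B + t * ?D x + (t * ?D x)\<^sup>2 / 2 \<le> exp (t * ?D x)"
        by linarith
      from mult_left_mono[OF this u(3)[of x]] show ?case
        by (simp add: algebra_simps power2_eq_square)
    qed
  qed (intro ebdd_integrable ebdd_intros block_diff_ebdd u)+
  finally show "(1 + (t\<^sup>2 * (real m * (v - 2 * e)) / 2 - ?B)) * (\<integral>x. u x \<partial>M) \<le> (\<integral>x. u x * exp (t * ?D x) \<partial>M)" .
qed

lemma integral_exp_mart_sum:
  assumes good: "good_block v e m" and t: "\<bar>t\<bar> * (2 * real m * C) \<le> 1" and v: "0 \<le> v" "0 \<le> e"
  defines "y \<equiv> t\<^sup>2 * (real m * (v + 2 * e)) / 2 + \<bar>t\<bar> ^ 3 * (2 * real m * C) ^ 3"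
    and "x \<equiv> t\<^sup>2 * (real m * (v - 2 * e)) / 2 - \<bar>t\<bar> ^ 3 * (2 * real m * C) ^ 3"
  shows "(\<integral>x. exp (t * mart_sum m q x) \<partial>M) \<le> exp (real q * y)"
    and "-1 \<le> x \<Longrightarrow> (1 + x) ^ q \<le> (\<integral>x. exp (t * mart_sum m q x) \<partial>M)"
proof -
  have eq: "(\<integral>x. exp (t * mart_sum m q x) \<partial>M) = (\<integral>x. (\<Prod>i<q. exp (t * block_diff m ((T ^^ (i * m)) x))) \<partial>M)"
    by (simp add: mart_sum_def sum_distrib_left exp_sum)
  have phi: "ebdd (\<lambda>x. exp (t * block_diff m x))" "(\<lambda>x. exp (t * block_diff m ((V ^^ m) x))) \<in> borel_measurable F"
    using block_diff_Vk_F by (auto intro!: ebdd_exp ebdd_cmult block_diff_ebdd)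
  have y: "0 \<le> y"
    using v C_nonneg by (auto simp: y_def)
  have "(\<integral>x. exp (t * mart_sum m q x) \<partial>M) \<le> (1 + y) ^ q"
    unfolding eq y_def
    by (rule orbit_prod_le[OF phi(1) _ phi(2)]) (use y integral_exp_block_diff(1)[OF good t] in \<open>auto simp: y_def\<close>)
  also have "\<dots> \<le> exp y ^ q"
    using y by (intro power_mono) auto
  finally show "(\<integral>x. exp (t * mart_sum m q x) \<partial>M) \<le> exp (real q * y)"
    by (simp add: exp_of_nat_mult)
  assume "-1 \<le> x"
  then show "(1 + x) ^ q \<le> (\<integral>x. exp (t * mart_sum m q x) \<partial>M)"
    unfolding eq x_def
    by (intro orbit_prod_ge[OF phi(1) _ phi(2)]) (use integral_exp_block_diff(2)[OF good t] in auto)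
qed

text \<open>The remainder of \<open>S\<^sub>n\<close> after removal of the martingale of the \<open>n div m\<close> full blocks.\<close>

definition remainder :: "nat \<Rightarrow> nat \<Rightarrow> 'a \<Rightarrow> real" where
  "remainder m n x = psum n x - mart_sum m (n div m) x"

lemma remainder_ebdd: "ebdd (remainder m n)"
  unfolding remainder_def by (intro ebdd_intros psum_ebdd mart_sum_ebdd)

lemma integral_exp_remainder:
  assumes good: "good_block v e m" and e: "0 \<le> e"
  shows "(\<integral>x. exp (t * remainder m n x) \<partial>M) \<le> exp (4096 * t\<^sup>2 * e\<^sup>2 * real n + \<bar>t\<bar> * real m * C)"
proof -
  let ?q = "n div m"
  have m: "1 \<le> m"
    using good by (simp add: good_block_def)
  have eq: "remainder m n x = drift_sum m ?q x + psum (n mod m) ((T ^^ (?q * m)) x)" for x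
    using psum_add[of "?q * m" "n mod m" x] by (simp add: remainder_def psum_decomp)
  have "AE x in M. \<bar>psum (n mod m) ((T ^^ (?q * m)) x)\<bar> \<le> real (n mod m) * C"
    by (rule AE_Tk) (rule abs_psum_le)
  moreover have "real (n mod m) * C \<le> real m * C"
    using m C_nonneg by (intro mult_right_mono) (auto simp: less_imp_le)
  ultimately have pt: "AE x in M. exp (t * remainder m n x) \<le> exp (\<bar>t\<bar> * real m * C) * exp (t * drift_sum m ?q x)"
  proof (elim eventually_mono)
    fix x assume "\<bar>psum (n mod m) ((T ^^ (?q * m)) x)\<bar> \<le> real (n mod m) * C"
    then have "\<bar>psum (n mod m) ((T ^^ (?q * m)) x)\<bar> \<le> real m * C"
      using \<open>real (n mod m) * C \<le> real m * C\<close> by linarith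
    then have "\<bar>t * psum (n mod m) ((T ^^ (?q * m)) x)\<bar> \<le> \<bar>t\<bar> * (real m * C)"
      unfolding abs_mult by (intro mult_left_mono) auto
    then have "t * remainder m n x \<le> \<bar>t\<bar> * real m * C + t * drift_sum m ?q x"
      unfolding eq distrib_left mult.assoc by linarith
    then show "exp (t * remainder m n x) \<le> exp (\<bar>t\<bar> * real m * C) * exp (t * drift_sum m ?q x)"
      by (simp flip: exp_add)
  qed
  have sub: "subgaussian (drift_sum m ?q) (64 * (e * sqrt (real m)) * sqrt (real ?q))"
    using good by (intro subgaussian_drift_sum) (simp add: good_block_def)
  have "real m * real ?q \<le> real n"
    by (metis of_nat_mult of_nat_le_iff times_div_less_eq_dividend)
  then have "t\<^sup>2 * (64 * (e * sqrt (real m)) * sqrt (real ?q))\<^sup>2 \<le> 4096 * t\<^sup>2 * e\<^sup>2 * real n"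
    using mult_left_mono[of "real m * real ?q" "real n" "4096 * t\<^sup>2 * e\<^sup>2"]
    by (simp add: power_mult_distrib mult_ac)
  then have "(\<integral>x. exp (t * drift_sum m ?q x) \<partial>M) \<le> exp (4096 * t\<^sup>2 * e\<^sup>2 * real n)"
    using subgaussianD[OF sub, of t] by (meson exp_le_cancel_iff order_trans)
  have "(\<integral>x. exp (t * remainder m n x) \<partial>M) \<le> (\<integral>x. exp (\<bar>t\<bar> * real m * C) * exp (t * drift_sum m ?q x) \<partial>M)"
    by (rule integral_mono_AE[OF _ _ pt]) (intro ebdd_integrable ebdd_intros remainder_ebdd drift_sum_ebdd)+
  also have "\<dots> = exp (\<bar>t\<bar> * real m * C) * (\<integral>x. exp (t * drift_sum m ?q x) \<partial>M)"
    by simp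
  also have "\<dots> \<le> exp (\<bar>t\<bar> * real m * C) * exp (4096 * t\<^sup>2 * e\<^sup>2 * real n)"
    by (intro mult_left_mono) (fact, simp)
  finally show ?thesis
    by (simp add: add.commute flip: exp_add)
qed

text \<open>The moment generating function of the \<open>n\<close>-th partial sum.\<close>

definition mgf :: "nat \<Rightarrow> real \<Rightarrow> real" where
  "mgf n t = (\<integral>x. exp (t * psum n x) \<partial>M)"

lemma mgf_pos: "0 < mgf n t"
proof -
  obtain K where K: "AE x in M. \<bar>psum n x\<bar> \<le> K"
    using psum_ebdd by (rule ebddE)
  have "exp (- (\<bar>t\<bar> * K)) = (\<integral>x. exp (- (\<bar>t\<bar> * K)) \<partial>M)"
    by (simp add: prob_space)
  also have "\<dots> \<le> mgf n t"
    unfolding mgf_def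
  proof (rule integral_mono_AE)
    show "AE x in M. exp (- (\<bar>t\<bar> * K)) \<le> exp (t * psum n x)"
      using K
    proof eventually_elim
      case (elim x)
      have "\<bar>t * psum n x\<bar> \<le> \<bar>t\<bar> * K"
        unfolding abs_mult using elim by (intro mult_left_mono) auto
      then show ?case
        by simp
    qed
  qed (intro ebdd_integrable ebdd_intros psum_ebdd)+
  finally show ?thesis
    by (meson exp_gt_zero order_less_le_trans)
qed

text \<open>Hoelder's inequality with exponents \<open>1 / (1 - e)\<close> and \<open>1 / e\<close> separates the martingale part
  of \<open>S\<^sub>n\<close> from the remainder.\<close>

lemma ln_mgf_le:
  assumes good: "good_block v e m" and e: "0 < e" "e < 1" and v: "0 \<le> v"
    and t: "\<bar>t\<bar> * (2 * real m * C) \<le> 1 - e"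
  shows "ln (mgf n t) \<le> real n * t\<^sup>2 * ((v + 2 * e) / (2 * (1 - e)) + 4096 * e)
    + real n * \<bar>t\<bar> ^ 3 * (2 * real m * C) ^ 3 / (1 - e)\<^sup>2 + \<bar>t\<bar> * real m * C"
proof -
  let ?w = "1 - e" and ?q = "n div m"
  let ?y = "(t / ?w)\<^sup>2 * (real m * (v + 2 * e)) / 2 + \<bar>t / ?w\<bar> ^ 3 * (2 * real m * C) ^ 3"
  let ?r = "4096 * (t / e)\<^sup>2 * e\<^sup>2 * real n + \<bar>t / e\<bar> * real m * C"
  have m: "1 \<le> m"
    using good by (simp add: good_block_def)
  have "\<bar>t / ?w\<bar> * (2 * real m * C) \<le> 1"
    using t e by (simp add: abs_divide divide_le_eq)
  then have 1: "(\<integral>x. exp (t / ?w * mart_sum m ?q x) \<partial>M) \<le> exp (real ?q * ?y)"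
    using v e by (intro integral_exp_mart_sum(1)[OF good]) auto
  have 2: "(\<integral>x. exp (t / e * remainder m n x) \<partial>M) \<le> exp ?r"
    using e by (intro integral_exp_remainder[OF good]) auto
  have "(\<integral>x. exp (?w * (t / ?w * mart_sum m ?q x) + (1 - ?w) * (t / e * remainder m n x)) \<partial>M)
      \<le> exp (?w * (real ?q * ?y) + (1 - ?w) * ?r)"
    using e by (intro integral_exp_convex 1 2 ebdd_intros mart_sum_ebdd remainder_ebdd) auto
  moreover have "?w * (t / ?w * mart_sum m ?q x) + (1 - ?w) * (t / e * remainder m n x) = t * psum n x" for x
  proof -
    have "?w * (t / ?w * mart_sum m ?q x) = t * mart_sum m ?q x"
      "(1 - ?w) * (t / e * remainder m n x) = t * remainder m n x"
      using e by simp_all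
    then show ?thesis
      by (simp add: remainder_def right_diff_distrib)
  qed
  ultimately have "mgf n t \<le> exp (?w * (real ?q * ?y) + (1 - ?w) * ?r)"
    by (simp add: mgf_def)
  then have "exp (ln (mgf n t)) \<le> exp (?w * (real ?q * ?y) + (1 - ?w) * ?r)"
    by (simp only: exp_ln mgf_pos)
  then have "ln (mgf n t) \<le> ?w * (real ?q * ?y) + (1 - ?w) * ?r"
    by (simp only: exp_le_cancel_iff)
  also have "(1 - ?w) * ?r = real n * t\<^sup>2 * (4096 * e) + \<bar>t\<bar> * real m * C"
    using e by (simp add: power2_eq_square field_simps)
  also have "?w * (real ?q * ?y) \<le> real n * t\<^sup>2 * ((v + 2 * e) / (2 * ?w)) + real n * \<bar>t\<bar> ^ 3 * (2 * real m * C) ^ 3 / ?w\<^sup>2"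
  proof -
    have qm: "real ?q * real m \<le> real n"
      by (metis of_nat_mult of_nat_le_iff div_times_less_eq_dividend)
    have q: "real ?q \<le> real n"
      by (simp add: div_le_dividend)
    have "?w * (real ?q * ?y) = real ?q * real m * (t\<^sup>2 * ((v + 2 * e) / (2 * ?w))) + real ?q * (\<bar>t\<bar> ^ 3 * (2 * real m * C) ^ 3 / ?w\<^sup>2)"
    proof -
      have "w * (k * ((t / w)\<^sup>2 * (r * b) / 2 + \<bar>t / w\<bar> ^ 3 * L))
          = k * r * (t\<^sup>2 * (b / (2 * w))) + k * (\<bar>t\<bar> ^ 3 * L / w\<^sup>2)" if "0 < w" for w k r b L :: real
        using that by (simp add: abs_divide power_divide power2_eq_square power3_eq_cube field_simps)
      then show ?thesis
        using e by simp
    qed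
    also have "\<dots> \<le> real n * (t\<^sup>2 * ((v + 2 * e) / (2 * ?w))) + real n * (\<bar>t\<bar> ^ 3 * (2 * real m * C) ^ 3 / ?w\<^sup>2)"
      using e v C_nonneg by (intro add_mono mult_right_mono qm q) auto
    finally show ?thesis
      by (simp add: mult_ac)
  qed
  finally show ?thesis
    by (simp add: distrib_left)
qed

lemma ln_mgf_ge:
  assumes good: "good_block v e m" and e: "0 < e" "e < 1" and v: "0 \<le> v"
    and t: "\<bar>t\<bar> * (2 * real m * C) \<le> 1"
  defines "s \<equiv> (1 - e) * t"
  defines "x \<equiv> s\<^sup>2 * (real m * (v - 2 * e)) / 2 - \<bar>s\<bar> ^ 3 * (2 * real m * C) ^ 3"
  assumes x: "\<bar>x\<bar> \<le> 1 / 2"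
  shows "real (n div m) * (x - 2 * x\<^sup>2) - (4096 * real n * t\<^sup>2 * e + \<bar>t\<bar> * real m * C) \<le> (1 - e) * ln (mgf n t)"
proof -
  let ?w = "1 - e" and ?q = "n div m"
  let ?b = "- (s / e)"
  let ?r = "4096 * ?b\<^sup>2 * e\<^sup>2 * real n + \<bar>?b\<bar> * real m * C"
  have s_le: "\<bar>s\<bar> \<le> \<bar>t\<bar>"
    using e by (simp add: s_def abs_mult mult_left_le_one_le)
  have "\<bar>s\<bar> * (2 * real m * C) \<le> \<bar>t\<bar> * (2 * real m * C)"
    using s_le C_nonneg by (intro mult_right_mono) auto
  then have s1: "\<bar>s\<bar> * (2 * real m * C) \<le> 1"
    using t by linarith
  have "-1 \<le> x"
    using x by linarith
  then have "(1 + x) ^ ?q \<le> (\<integral>x. exp (s * mart_sum m ?q x) \<partial>M)"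
    unfolding x_def using v e by (intro integral_exp_mart_sum(2)[OF good s1]) auto
  also have "\<dots> \<le> exp (?w * ln (mgf n t) + (1 - ?w) * ?r)"
  proof -
    have 1: "(\<integral>x. exp (t * psum n x) \<partial>M) \<le> exp (ln (mgf n t))"
      using mgf_pos[of n t] by (simp add: mgf_def)
    have 2: "(\<integral>x. exp (?b * remainder m n x) \<partial>M) \<le> exp ?r"
      using e by (intro integral_exp_remainder[OF good]) auto
    have "(\<integral>x. exp (?w * (t * psum n x) + (1 - ?w) * (?b * remainder m n x)) \<partial>M)
        \<le> exp (?w * ln (mgf n t) + (1 - ?w) * ?r)"
      using e by (intro integral_exp_convex 1 2 ebdd_intros psum_ebdd remainder_ebdd) auto
    moreover have "?w * (t * psum n x) + (1 - ?w) * (?b * remainder m n x) = s * mart_sum m ?q x" for x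
    proof -
      have "?w * (t * psum n x) = s * psum n x" "(1 - ?w) * (?b * remainder m n x) = - s * remainder m n x"
        using e by (simp_all add: s_def)
      then show ?thesis
        by (simp add: remainder_def right_diff_distrib)
    qed
    ultimately show ?thesis
      by simp
  qed
  finally have "exp (real ?q * ln (1 + x)) \<le> exp (?w * ln (mgf n t) + (1 - ?w) * ?r)"
    using x by (simp add: exp_of_nat_mult)
  then have "real ?q * ln (1 + x) \<le> ?w * ln (mgf n t) + (1 - ?w) * ?r"
    by simp
  moreover have "real ?q * (x - 2 * x\<^sup>2) \<le> real ?q * ln (1 + x)"
    using abs_ln_one_plus_x_minus_x_bound[OF x] by (intro mult_left_mono) auto
  moreover have "(1 - ?w) * ?r \<le> 4096 * real n * t\<^sup>2 * e + \<bar>t\<bar> * real m * C"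
  proof -
    have "(1 - ?w) * ?r = 4096 * real n * e * s\<^sup>2 + real m * C * \<bar>s\<bar>"
      using e by (simp add: power2_eq_square field_simps)
    also have "\<dots> \<le> 4096 * real n * e * t\<^sup>2 + real m * C * \<bar>t\<bar>"
      using e C_nonneg s_le power_mono[OF s_le, of 2] by (intro add_mono mult_left_mono) auto
    finally show ?thesis
      by (simp add: mult_ac)
  qed
  ultimately show ?thesis
    by linarith
qed

end

section \<open>Asymptotics of the logarithmic moment generating function\<close>

lemma scaling_limits:
  fixes a :: "nat \<Rightarrow> real"
  assumes a_lim: "a \<longlonglongrightarrow> 0"
    and a_growth: "filterlim (\<lambda>n. a n * sqrt (real n)) at_top sequentially"
  shows "(\<lambda>n. 1 / (a n * sqrt (real n))) \<longlonglongrightarrow> 0" "(\<lambda>n. a n / sqrt (real n)) \<longlonglongrightarrow> 0"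
proof -
  show "(\<lambda>n. 1 / (a n * sqrt (real n))) \<longlonglongrightarrow> 0"
    using tendsto_inverse_0_at_top[OF a_growth] by (simp only: inverse_eq_divide)
  have "(\<lambda>n. a n * inverse (sqrt (real n))) \<longlonglongrightarrow> 0 * 0"
    by (intro tendsto_mult a_lim tendsto_inverse_0_at_top filterlim_compose[OF sqrt_at_top]
        filterlim_real_sequentially)
  then show "(\<lambda>n. a n / sqrt (real n)) \<longlonglongrightarrow> 0"
    by (simp add: divide_inverse)
qed

lemma div_over_limit:
  assumes "1 \<le> (m :: nat)"
  shows "(\<lambda>n. real (n div m) / real n) \<longlonglongrightarrow> 1 / real m"
proof (rule tendsto_sandwich)
  have "(\<lambda>n. 1 / real m - inverse (real n)) \<longlonglongrightarrow> 1 / real m - 0"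
    by (intro tendsto_intros tendsto_inverse_0_at_top filterlim_real_sequentially)
  then show "(\<lambda>n. 1 / real m - inverse (real n)) \<longlonglongrightarrow> 1 / real m"
    by simp
  show "(\<lambda>n. 1 / real m) \<longlonglongrightarrow> 1 / real m"
    by simp
  have m: "0 < real m"
    using assms by simp
  have le: "real (n div m) * real m \<le> real n" "real n \<le> real (n div m) * real m + real m" for n
  proof -
    have "real n = real (n div m) * real m + real (n mod m)"
      by (metis div_mult_mod_eq of_nat_add of_nat_mult)
    moreover have "real (n mod m) \<le> real m"
      using assms by (simp add: less_imp_le)
    ultimately show "real (n div m) * real m \<le> real n" "real n \<le> real (n div m) * real m + real m"
      by linarith+
  qed
  show "\<forall>\<^sub>F n in sequentially. 1 / real m - inverse (real n) \<le> real (n div m) / real n"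
    using eventually_gt_at_top[of "0::nat"]
  proof eventually_elim
    case (elim n)
    have "1 / real m \<le> (real (n div m) + 1) / real n"
      using le(2)[of n] m elim by (simp add: pos_divide_le_eq pos_le_divide_eq distrib_right)
    then show ?case
      by (simp add: add_divide_distrib inverse_eq_divide)
  qed
  show "\<forall>\<^sub>F n in sequentially. real (n div m) / real n \<le> 1 / real m"
    using eventually_gt_at_top[of "0::nat"]
  proof eventually_elim
    case (elim n)
    then show ?case
      using le(1)[of n] m by (simp add: field_simps)
  qed
qed

context bounded_adapted
begin

lemma mgf_eventually_le:
  fixes a :: "nat \<Rightarrow> real"
  assumes good: "\<And>e. 0 < e \<Longrightarrow> \<exists>m. good_block v e m" and v: "0 \<le> v"
    and a_pos: "\<And>n. 1 \<le> n \<Longrightarrow> 0 < a n" and a_lim: "a \<longlonglongrightarrow> 0"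
    and a_growth: "filterlim (\<lambda>n. a n * sqrt (real n)) at_top sequentially"
    and \<epsilon>: "0 < \<epsilon>"
  shows "\<forall>\<^sub>F n in sequentially. mgf n (c / (a n * sqrt (real n))) \<le> exp ((c\<^sup>2 * v / 2 + \<epsilon>) / (a n)\<^sup>2)"
proof -
  \<comment> \<open>the limit of the bound in \<open>ln_mgf_le\<close> for fixed \<open>e\<close>, which tends to \<open>c\<^sup>2 v / 2\<close> as \<open>e\<close> tends to \<open>0\<close>\<close>
  let ?f = "\<lambda>e. c\<^sup>2 * ((v + 2 * e) / (2 * (1 - e)) + 4096 * e)"
  have "(?f \<longlongrightarrow> c\<^sup>2 * ((v + 2 * 0) / (2 * (1 - 0)) + 4096 * 0)) (at_right 0)"
    by (intro tendsto_intros) auto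
  then have "\<forall>\<^sub>F e in at_right 0. ?f e < c\<^sup>2 * v / 2 + \<epsilon>"
    using \<epsilon> by (intro order_tendstoD) auto
  moreover have "\<forall>\<^sub>F e::real in at_right 0. e \<in> {0<..<1}"
    by (intro eventually_at_right_real) auto
  ultimately have "\<forall>\<^sub>F e in at_right 0. ?f e < c\<^sup>2 * v / 2 + \<epsilon> \<and> e \<in> {0<..<1}"
    by (rule eventually_conj)
  then obtain e where e: "?f e < c\<^sup>2 * v / 2 + \<epsilon>" "0 < e" "e < 1"
    using eventually_happens[of _ "at_right (0::real)"] by (auto simp: trivial_limit_at_right_real)
  obtain m where m: "good_block v e m"
    using good e by blast
  define L where "L = 2 * real m * C"
  define z where "z n = 1 / (a n * sqrt (real n))" for n
  define g where "g n = ?f e + \<bar>c\<bar> ^ 3 * L ^ 3 / (1 - e)\<^sup>2 * z n + \<bar>c\<bar> * (real m * C) * (a n / sqrt (real n))" for n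
  note lim = scaling_limits[OF a_lim a_growth, folded z_def]
  have "g \<longlonglongrightarrow> ?f e + \<bar>c\<bar> ^ 3 * L ^ 3 / (1 - e)\<^sup>2 * 0 + \<bar>c\<bar> * (real m * C) * 0"
    unfolding g_def by (intro tendsto_add tendsto_mult tendsto_const lim)
  then have ev1: "\<forall>\<^sub>F n in sequentially. g n < c\<^sup>2 * v / 2 + \<epsilon>"
    using e by (intro order_tendstoD) auto
  have "(\<lambda>n. \<bar>c * z n\<bar> * L) \<longlonglongrightarrow> \<bar>c * 0\<bar> * L"
    by (intro tendsto_intros lim)
  then have ev2: "\<forall>\<^sub>F n in sequentially. \<bar>c * z n\<bar> * L < 1 - e"
    using e by (intro order_tendstoD) auto
  show ?thesis
    using ev1 ev2 eventually_ge_at_top[of "1::nat"]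
  proof eventually_elim
    case (elim n)
    define t where "t = c / (a n * sqrt (real n))"
    have t: "t = c * z n"
      by (simp add: t_def z_def)
    have a: "0 < a n" and n: "0 < sqrt (real n)" "real n = (sqrt (real n))\<^sup>2"
      using a_pos elim by auto
    have id1: "(a n)\<^sup>2 * (real n * t\<^sup>2) = c\<^sup>2"
      unfolding t_def using a n(1) by (subst n(2)) (simp add: power2_eq_square field_simps)
    have id2: "(a n)\<^sup>2 * (real n * \<bar>t\<bar> ^ 3) = \<bar>c\<bar> ^ 3 * z n"
      unfolding t_def z_def using a n(1)
      by (subst n(2)) (simp add: abs_divide abs_mult power2_eq_square power3_eq_cube field_simps)
    have id3: "(a n)\<^sup>2 * \<bar>t\<bar> = \<bar>c\<bar> * (a n / sqrt (real n))"
      unfolding t_def using a n(1) by (simp add: abs_divide abs_mult power2_eq_square field_simps)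
    have "ln (mgf n t) \<le> real n * t\<^sup>2 * ((v + 2 * e) / (2 * (1 - e)) + 4096 * e)
        + real n * \<bar>t\<bar> ^ 3 * L ^ 3 / (1 - e)\<^sup>2 + \<bar>t\<bar> * real m * C"
      unfolding L_def by (rule ln_mgf_le[OF m e(2,3) v]) (use elim t in \<open>simp add: L_def\<close>)
    then have "(a n)\<^sup>2 * ln (mgf n t) \<le> (a n)\<^sup>2 * (real n * t\<^sup>2 * ((v + 2 * e) / (2 * (1 - e)) + 4096 * e)
        + real n * \<bar>t\<bar> ^ 3 * L ^ 3 / (1 - e)\<^sup>2 + \<bar>t\<bar> * real m * C)"
      by (intro mult_left_mono) auto
    also have "\<dots> = (a n)\<^sup>2 * (real n * t\<^sup>2) * ((v + 2 * e) / (2 * (1 - e)) + 4096 * e)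
        + (a n)\<^sup>2 * (real n * \<bar>t\<bar> ^ 3) * L ^ 3 / (1 - e)\<^sup>2 + (a n)\<^sup>2 * \<bar>t\<bar> * (real m * C)"
      by (simp add: distrib_left mult.assoc)
    also have "\<dots> = g n"
      unfolding id1 id2 id3 g_def by (simp add: mult_ac)
    also have "\<dots> \<le> c\<^sup>2 * v / 2 + \<epsilon>"
      using elim by simp
    finally have "ln (mgf n t) \<le> (c\<^sup>2 * v / 2 + \<epsilon>) / (a n)\<^sup>2"
      using a by (simp add: pos_le_divide_eq mult.commute)
    then have "exp (ln (mgf n t)) \<le> exp ((c\<^sup>2 * v / 2 + \<epsilon>) / (a n)\<^sup>2)"
      by (simp only: exp_le_cancel_iff)
    then show ?case
      by (simp only: exp_ln mgf_pos t_def)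
  qed
qed

lemma mgf_eventually_ge:
  fixes a :: "nat \<Rightarrow> real"
  assumes good: "\<And>e. 0 < e \<Longrightarrow> \<exists>m. good_block v e m" and v: "0 \<le> v"
    and a_pos: "\<And>n. 1 \<le> n \<Longrightarrow> 0 < a n" and a_lim: "a \<longlonglongrightarrow> 0"
    and a_growth: "filterlim (\<lambda>n. a n * sqrt (real n)) at_top sequentially"
    and \<epsilon>: "0 < \<epsilon>"
  shows "\<forall>\<^sub>F n in sequentially. exp ((c\<^sup>2 * v / 2 - \<epsilon>) / (a n)\<^sup>2) \<le> mgf n (c / (a n * sqrt (real n)))"
proof -
  \<comment> \<open>the limit of the bound in \<open>ln_mgf_ge\<close> for fixed \<open>e\<close>, minus \<open>1 - e\<close> times the target\<close>
  let ?f = "\<lambda>e. ((1 - e) * c)\<^sup>2 * (v - 2 * e) / 2 - 4096 * c\<^sup>2 * e - (1 - e) * (c\<^sup>2 * v / 2 - \<epsilon>)"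
  have "(?f \<longlongrightarrow> ((1 - 0) * c)\<^sup>2 * (v - 2 * 0) / 2 - 4096 * c\<^sup>2 * 0 - (1 - 0) * (c\<^sup>2 * v / 2 - \<epsilon>)) (at_right 0)"
    by (intro tendsto_intros) auto
  then have "\<forall>\<^sub>F e in at_right 0. 0 < ?f e"
    using \<epsilon> by (intro order_tendstoD) auto
  moreover have "\<forall>\<^sub>F e::real in at_right 0. e \<in> {0<..<1}"
    by (intro eventually_at_right_real) auto
  ultimately have "\<forall>\<^sub>F e in at_right 0. 0 < ?f e \<and> e \<in> {0<..<1}"
    by (rule eventually_conj)
  then obtain e where e: "0 < ?f e" "0 < e" "e < 1"
    using eventually_happens[of _ "at_right (0::real)"] by (auto simp: trivial_limit_at_right_real)
  obtain m where m: "good_block v e m"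
    using good e by blast
  then have m1: "1 \<le> m"
    by (simp add: good_block_def)
  define L where "L = 2 * real m * C"
  define z where "z n = 1 / (a n * sqrt (real n))" for n
  define A where "A = ((1 - e) * c)\<^sup>2 * (real m * (v - 2 * e)) / 2"
  define B where "B = \<bar>(1 - e) * c\<bar> ^ 3 * L ^ 3"
  define g where "g n = real (n div m) / real n * ((A - B * z n) - 2 * (z n)\<^sup>2 * (A - B * z n)\<^sup>2)
      - (4096 * c\<^sup>2 * e + \<bar>c\<bar> * (real m * C) * (a n / sqrt (real n)))" for n
  note lim = scaling_limits[OF a_lim a_growth, folded z_def]
  have "g \<longlonglongrightarrow> 1 / real m * ((A - B * 0) - 2 * 0\<^sup>2 * (A - B * 0)\<^sup>2) - (4096 * c\<^sup>2 * e + \<bar>c\<bar> * (real m * C) * 0)"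
    unfolding g_def
    by (intro tendsto_add tendsto_mult tendsto_diff tendsto_power tendsto_const lim div_over_limit m1)
  then have ev1: "\<forall>\<^sub>F n in sequentially. (1 - e) * (c\<^sup>2 * v / 2 - \<epsilon>) < g n"
    using e m1 by (intro order_tendstoD) (auto simp: A_def)
  have "(\<lambda>n. \<bar>c * z n\<bar> * L) \<longlonglongrightarrow> \<bar>c * 0\<bar> * L"
    by (intro tendsto_intros lim)
  then have ev2: "\<forall>\<^sub>F n in sequentially. \<bar>c * z n\<bar> * L < 1"
    by (intro order_tendstoD) auto
  have "(\<lambda>n. \<bar>(z n)\<^sup>2 * (A - B * z n)\<bar>) \<longlonglongrightarrow> \<bar>0\<^sup>2 * (A - B * 0)\<bar>"
    by (intro tendsto_intros lim)
  then have ev3: "\<forall>\<^sub>F n in sequentially. \<bar>(z n)\<^sup>2 * (A - B * z n)\<bar> < 1 / 2"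
    by (intro order_tendstoD) auto
  show ?thesis
    using ev1 ev2 ev3 eventually_ge_at_top[of "1::nat"]
  proof eventually_elim
    case (elim n)
    define t where "t = c / (a n * sqrt (real n))"
    define x where "x = ((1 - e) * t)\<^sup>2 * (real m * (v - 2 * e)) / 2 - \<bar>(1 - e) * t\<bar> ^ 3 * L ^ 3"
    have t: "t = c * z n"
      by (simp add: t_def z_def)
    have a: "0 < a n" and n: "0 < sqrt (real n)" "real n = (sqrt (real n))\<^sup>2"
      using a_pos elim by auto
    have z: "0 < z n"
      using a n(1) by (simp add: z_def)
    have scale: "(k * z n)\<^sup>2 * b / 2 - \<bar>k * z n\<bar> ^ 3 * l = (z n)\<^sup>2 * (k\<^sup>2 * b / 2 - \<bar>k\<bar> ^ 3 * l * z n)" for k b l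
      using z by (simp add: abs_mult power_mult_distrib power2_eq_square power3_eq_cube algebra_simps)
    have "(1 - e) * t = (1 - e) * c * z n"
      by (simp add: t)
    then have x: "x = (z n)\<^sup>2 * (A - B * z n)"
      unfolding x_def A_def B_def by (simp only: scale)
    have id0: "(a n)\<^sup>2 * (z n)\<^sup>2 = 1 / real n"
      unfolding z_def using a n(1) by (subst n(2)) (simp add: power2_eq_square field_simps)
    have id1: "(a n)\<^sup>2 * (real n * t\<^sup>2) = c\<^sup>2"
      unfolding t_def using a n(1) by (subst n(2)) (simp add: power2_eq_square field_simps)
    have id3: "(a n)\<^sup>2 * \<bar>t\<bar> = \<bar>c\<bar> * (a n / sqrt (real n))"
      unfolding t_def using a n(1) by (simp add: abs_divide abs_mult power2_eq_square field_simps)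
    have "real (n div m) * (x - 2 * x\<^sup>2) - (4096 * real n * t\<^sup>2 * e + \<bar>t\<bar> * real m * C) \<le> (1 - e) * ln (mgf n t)"
      unfolding x_def L_def
      by (rule ln_mgf_ge[OF m e(2,3) v])
        (use elim x t in \<open>simp_all add: x_def L_def del: abs_mult\<close>)
    then have "(a n)\<^sup>2 * (real (n div m) * (x - 2 * x\<^sup>2) - (4096 * real n * t\<^sup>2 * e + \<bar>t\<bar> * real m * C))
        \<le> (a n)\<^sup>2 * ((1 - e) * ln (mgf n t))"
      by (intro mult_left_mono) auto
    moreover have "(a n)\<^sup>2 * (real (n div m) * (x - 2 * x\<^sup>2) - (4096 * real n * t\<^sup>2 * e + \<bar>t\<bar> * real m * C)) = g n"
    proof -
      have "(a n)\<^sup>2 * (real (n div m) * (x - 2 * x\<^sup>2) - (4096 * real n * t\<^sup>2 * e + \<bar>t\<bar> * real m * C))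
          = (a n)\<^sup>2 * (z n)\<^sup>2 * real (n div m) * ((A - B * z n) - 2 * (z n)\<^sup>2 * (A - B * z n)\<^sup>2)
            - (4096 * ((a n)\<^sup>2 * (real n * t\<^sup>2)) * e + (a n)\<^sup>2 * \<bar>t\<bar> * (real m * C))"
        unfolding x by (simp add: power2_eq_square right_diff_distrib distrib_left mult_ac)
      then show ?thesis
        unfolding id0 id1 id3 g_def by (simp add: mult_ac)
    qed
    ultimately have "(1 - e) * (c\<^sup>2 * v / 2 - \<epsilon>) < (1 - e) * ((a n)\<^sup>2 * ln (mgf n t))"
      using elim(1) by (simp add: mult.left_commute)
    then have "c\<^sup>2 * v / 2 - \<epsilon> < (a n)\<^sup>2 * ln (mgf n t)"
      using e by (simp add: mult_less_cancel_left_pos)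
    then have "(c\<^sup>2 * v / 2 - \<epsilon>) / (a n)\<^sup>2 \<le> ln (mgf n t)"
      using a by (simp add: pos_divide_le_eq mult.commute)
    then have "exp ((c\<^sup>2 * v / 2 - \<epsilon>) / (a n)\<^sup>2) \<le> exp (ln (mgf n t))"
      by (simp only: exp_le_cancel_iff)
    then show ?case
      by (simp only: exp_ln mgf_pos t_def)
  qed
qed

end

section \<open>From exponential moments to a large deviation principle\<close>

text \<open>A family whose logarithmic moment generating functions, at speed \<open>s n\<close>, converge to that of
  a centred Gaussian of variance \<open>v\<close>.\<close>

locale gaussian_mgf_limit = prob_space M for M :: "'a measure" +
  fixes Y :: "nat \<Rightarrow> 'a \<Rightarrow> real" and s :: "nat \<Rightarrow> real" and v :: real
  assumes Y_meas [measurable]: "\<And>n. Y n \<in> borel_measurable M"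
    and exp_int: "\<And>n c. integrable M (\<lambda>x. exp (c * Y n x))"
    and s_pos: "\<And>n. 1 \<le> n \<Longrightarrow> 0 < s n"
    and s_lim: "filterlim s at_top sequentially"
    and v_pos: "0 < v"
    and mgf_le: "\<And>c \<epsilon>. 0 < \<epsilon> \<Longrightarrow>
      \<forall>\<^sub>F n in sequentially. (\<integral>x. exp (c * s n * Y n x) \<partial>M) \<le> exp (s n * (c\<^sup>2 * v / 2 + \<epsilon>))"
    and mgf_ge: "\<And>c \<epsilon>. 0 < \<epsilon> \<Longrightarrow>
      \<forall>\<^sub>F n in sequentially. exp (s n * (c\<^sup>2 * v / 2 - \<epsilon>)) \<le> (\<integral>x. exp (c * s n * Y n x) \<partial>M)"
begin

lemma tail_le:
  assumes r: "0 \<le> r" and \<epsilon>: "0 < \<epsilon>"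
  shows "\<forall>\<^sub>F n in sequentially.
    measure M {x \<in> space M. r \<le> \<bar>Y n x\<bar>} \<le> 2 * exp (- (s n * (r\<^sup>2 / (2 * v) - \<epsilon>)))"
proof -
  let ?c = "r / v"
  have c: "?c\<^sup>2 * v / 2 - ?c * r = - (r\<^sup>2 / (2 * v))" "(- ?c)\<^sup>2 * v / 2 = ?c\<^sup>2 * v / 2"
    using v_pos by (simp_all add: power2_eq_square field_simps)
  show ?thesis
    using mgf_le[OF \<epsilon>, of ?c] mgf_le[OF \<epsilon>, of "- ?c"] eventually_ge_at_top[of "1::nat"]
  proof eventually_elim
    case (elim n)
    have s: "0 < s n"
      using s_pos elim by simp
    have int: "integrable M (\<lambda>x. exp (?c * s n * Y n x))" "integrable M (\<lambda>x. exp (- ?c * s n * Y n x))"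
      by (rule exp_int)+
    have "measure M {x \<in> space M. r \<le> \<bar>Y n x\<bar>} = (\<integral>x. indicator {x \<in> space M. r \<le> \<bar>Y n x\<bar>} x \<partial>M)"
      by simp
    also have "\<dots> \<le> (\<integral>x. exp (- (?c * s n * r)) * (exp (?c * s n * Y n x) + exp (- ?c * s n * Y n x)) \<partial>M)"
    proof (rule integral_mono)
      show "integrable M (indicat_real {x \<in> space M. r \<le> \<bar>Y n x\<bar>})"
        by (rule integrable_real_indicator) (auto simp: less_top[symmetric])
      show "integrable M (\<lambda>x. exp (- (?c * s n * r)) * (exp (?c * s n * Y n x) + exp (- ?c * s n * Y n x)))"
        using int by simp
      fix x
      let ?R = "exp (- (?c * s n * r)) * (exp (?c * s n * Y n x) + exp (- ?c * s n * Y n x))"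
      have k: "0 \<le> ?c * s n"
        using r v_pos s by simp
      show "indicat_real {x \<in> space M. r \<le> \<bar>Y n x\<bar>} x \<le> ?R"
      proof (cases "r \<le> \<bar>Y n x\<bar>")
        case True
        have "?c * s n * r \<le> ?c * s n * \<bar>Y n x\<bar>"
          by (rule mult_left_mono[OF True k])
        then have "exp (?c * s n * r) \<le> exp (?c * s n * \<bar>Y n x\<bar>)"
          by simp
        also have "\<dots> \<le> exp (?c * s n * Y n x) + exp (- ?c * s n * Y n x)"
          by (cases "0 \<le> Y n x") simp_all
        finally have "exp (- (?c * s n * r)) * exp (?c * s n * r) \<le> ?R"
          by (intro mult_left_mono) auto
        then show ?thesis
          by (simp add: indicator_def flip: exp_add)
      qed (simp add: indicator_def)
    qed
    also have "\<dots> = exp (- (?c * s n * r)) * ((\<integral>x. exp (?c * s n * Y n x) \<partial>M) + (\<integral>x. exp (- ?c * s n * Y n x) \<partial>M))"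
      using int by simp
    also have "\<dots> \<le> exp (- (?c * s n * r)) * (exp (s n * (?c\<^sup>2 * v / 2 + \<epsilon>)) + exp (s n * (?c\<^sup>2 * v / 2 + \<epsilon>)))"
      using elim(1,2) unfolding c(2) by (intro mult_left_mono add_mono) auto
    also have "\<dots> = 2 * exp (s n * ((?c\<^sup>2 * v / 2 - ?c * r) + \<epsilon>))"
      by (simp add: algebra_simps flip: exp_add)
    also have "\<dots> = 2 * exp (- (s n * (r\<^sup>2 / (2 * v) - \<epsilon>)))"
      unfolding c(1) by (simp add: algebra_simps)
    finally show ?case .
  qed
qed

text \<open>Under the tilted law with parameter \<open>c = y / v\<close> the window of half-width \<open>d\<close> around \<open>y\<close> keeps
  at least half of the mass, because the two complementary tails are exponentially small by a
  further tilt by \<open>d / v\<close> or \<open>- d / v\<close>.\<close>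

lemma window_ge:
  assumes d: "0 < d" and \<epsilon>: "0 < \<epsilon>"
  shows "\<forall>\<^sub>F n in sequentially.
    exp (- (s n * (y\<^sup>2 / (2 * v) + \<bar>y\<bar> * d / v + \<epsilon>))) \<le> measure M {x \<in> space M. \<bar>Y n x - y\<bar> < d}"
proof -
  define c k \<eta> where "c = y / v" and "k = d / v" and "\<eta> = min (\<epsilon> / 2) (d\<^sup>2 / (8 * v))"
  have k: "0 < k" and \<eta>: "0 < \<eta>" "\<eta> \<le> \<epsilon> / 2" "\<eta> \<le> d\<^sup>2 / (8 * v)"
    using d v_pos \<epsilon> by (auto simp: k_def \<eta>_def)
  have e1: "- k * (y + d) + (c + k)\<^sup>2 * v / 2 = c\<^sup>2 * v / 2 - d\<^sup>2 / (2 * v)"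
    and e2: "k * (y - d) + (c - k)\<^sup>2 * v / 2 = c\<^sup>2 * v / 2 - d\<^sup>2 / (2 * v)"
    and e3: "c\<^sup>2 * v / 2 - (c * y + \<bar>c\<bar> * d) = - (y\<^sup>2 / (2 * v) + \<bar>y\<bar> * d / v)"
    using v_pos by (simp_all add: c_def k_def power2_eq_square field_simps)
  have "filterlim (\<lambda>n. b * s n) at_top sequentially" if "0 < b" for b
    by (rule filterlim_tendsto_pos_mult_at_top[OF tendsto_const that s_lim])
  then have large: "\<forall>\<^sub>F n in sequentially. l \<le> b * s n" if "0 < b" for b l
    using that unfolding filterlim_at_top by blast
  have "\<forall>\<^sub>F n in sequentially. ln 4 \<le> d\<^sup>2 / (4 * v) * s n" "\<forall>\<^sub>F n in sequentially. ln 2 \<le> \<epsilon> / 2 * s n"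
    using d v_pos \<epsilon> by (auto intro!: large simp del: times_divide_eq_left)
  then show ?thesis
    using mgf_le[OF \<eta>(1), of "c + k"] mgf_le[OF \<eta>(1), of "c - k"] mgf_ge[OF \<eta>(1), of c]
      eventually_ge_at_top[of "1::nat"]
  proof eventually_elim
    case (elim n)
    have s: "0 < s n"
      using s_pos elim by simp
    let ?W = "{x \<in> space M. \<bar>Y n x - y\<bar> < d}"
    let ?E = "\<lambda>b x. exp (b * s n * Y n x)"
    let ?u = "exp (s n * (c * y + \<bar>c\<bar> * d))" and ?p = "exp (s n * (- k * (y + d)))" and ?q = "exp (s n * (k * (y - d)))"
    have iW: "integrable M (indicat_real ?W)"
      by (rule integrable_real_indicator) (auto simp: less_top[symmetric])
    have pt: "?E c x \<le> ?u * indicat_real ?W x + ?p * ?E (c + k) x + ?q * ?E (c - k) x" if x: "x \<in> space M" for x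
    proof -
      consider "\<bar>Y n x - y\<bar> < d" | "y + d \<le> Y n x" | "Y n x \<le> y - d"
        by linarith
      then show ?thesis
      proof cases
        case 1
        have "c * (Y n x - y) \<le> \<bar>c\<bar> * d"
          using 1 by (metis abs_ge_self abs_mult abs_ge_zero mult_left_mono order_trans less_imp_le)
        then have "c * Y n x \<le> c * y + \<bar>c\<bar> * d"
          by (simp add: right_diff_distrib)
        then have "?E c x \<le> ?u * indicat_real ?W x"
          using mult_left_mono[of "c * Y n x" _ "s n"] s 1 x by (simp add: mult_ac)
        moreover have "0 \<le> ?p * ?E (c + k) x" "0 \<le> ?q * ?E (c - k) x"
          by auto
        ultimately show ?thesis
          by linarith
      next
        case 2
        have "s n * (c * Y n x) \<le> s n * (- k * (y + d) + (c + k) * Y n x)"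
          using mult_left_mono[OF 2, of k] k s by (intro mult_left_mono) (auto simp: algebra_simps)
        then have "?E c x \<le> ?p * ?E (c + k) x"
          by (simp add: algebra_simps flip: exp_add)
        moreover have "0 \<le> ?u * indicat_real ?W x" "0 \<le> ?q * ?E (c - k) x"
          by (auto simp: indicator_def)
        ultimately show ?thesis
          by linarith
      next
        case 3
        have "s n * (c * Y n x) \<le> s n * (k * (y - d) + (c - k) * Y n x)"
          using mult_left_mono[OF 3, of k] k s by (intro mult_left_mono) (auto simp: algebra_simps)
        then have "?E c x \<le> ?q * ?E (c - k) x"
          by (simp add: algebra_simps flip: exp_add)
        moreover have "0 \<le> ?u * indicat_real ?W x" "0 \<le> ?p * ?E (c + k) x"
          by (auto simp: indicator_def)
        ultimately show ?thesis
          by linarith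
      qed
    qed
    let ?G = "exp (s n * (c\<^sup>2 * v / 2 - \<eta>))" and ?H = "exp (s n * (c\<^sup>2 * v / 2 - d\<^sup>2 / (2 * v) + \<eta>))"
    have "?G \<le> (\<integral>x. ?E c x \<partial>M)"
      using elim by simp
    also have "\<dots> \<le> (\<integral>x. ?u * indicat_real ?W x + ?p * ?E (c + k) x + ?q * ?E (c - k) x \<partial>M)"
      using iW exp_int by (intro integral_mono pt) auto
    also have "\<dots> = ?u * measure M ?W + ?p * (\<integral>x. ?E (c + k) x \<partial>M) + ?q * (\<integral>x. ?E (c - k) x \<partial>M)"
      using iW exp_int by simp
    also have "\<dots> \<le> ?u * measure M ?W + ?p * exp (s n * ((c + k)\<^sup>2 * v / 2 + \<eta>)) + ?q * exp (s n * ((c - k)\<^sup>2 * v / 2 + \<eta>))"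
      using elim by (intro add_mono mult_left_mono) auto
    also have "\<dots> = ?u * measure M ?W + exp (s n * ((- k * (y + d) + (c + k)\<^sup>2 * v / 2) + \<eta>))
        + exp (s n * ((k * (y - d) + (c - k)\<^sup>2 * v / 2) + \<eta>))"
      by (simp add: distrib_left add.assoc flip: exp_add)
    also have "\<dots> = ?u * measure M ?W + 2 * ?H"
      unfolding e1 e2 by simp
    finally have main: "?G \<le> ?u * measure M ?W + 2 * ?H" .
    have "ln 4 + s n * (c\<^sup>2 * v / 2 - d\<^sup>2 / (2 * v) + \<eta>) \<le> s n * (c\<^sup>2 * v / 2 - \<eta>)"
    proof -
      have "s n * (d\<^sup>2 / (4 * v)) \<le> s n * (d\<^sup>2 / (2 * v) - 2 * \<eta>)"
        using \<eta>(3) s v_pos by (intro mult_left_mono) (auto simp: field_simps)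
      then show ?thesis
        using elim by (simp add: algebra_simps)
    qed
    then have "exp (ln 4 + s n * (c\<^sup>2 * v / 2 - d\<^sup>2 / (2 * v) + \<eta>)) \<le> ?G"
      by (simp only: exp_le_cancel_iff)
    then have "4 * ?H \<le> ?G"
      by (simp add: exp_add)
    then have half: "?G / 2 \<le> ?u * measure M ?W"
      using main by linarith
    have "ln 2 - s n * (y\<^sup>2 / (2 * v) + \<bar>y\<bar> * d / v + \<epsilon>) \<le> s n * (- (y\<^sup>2 / (2 * v) + \<bar>y\<bar> * d / v) - \<eta>)"
    proof -
      have "s n * \<eta> \<le> s n * (\<epsilon> / 2)"
        using \<eta>(2) s by (intro mult_left_mono) auto
      then show ?thesis
        using elim by (simp add: algebra_simps)
    qed
    also have "\<dots> = s n * (c\<^sup>2 * v / 2 - \<eta>) - s n * (c * y + \<bar>c\<bar> * d)"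
      unfolding e3[symmetric] by (simp add: algebra_simps)
    finally have tilt: "exp (ln 2 - s n * (y\<^sup>2 / (2 * v) + \<bar>y\<bar> * d / v + \<epsilon>)) \<le> exp (s n * (c\<^sup>2 * v / 2 - \<eta>) - s n * (c * y + \<bar>c\<bar> * d))"
      by (simp only: exp_le_cancel_iff)
    then have "2 * exp (- (s n * (y\<^sup>2 / (2 * v) + \<bar>y\<bar> * d / v + \<epsilon>))) \<le> ?G / ?u"
    proof -
      have "exp (ln 2 - R) = 2 * exp (- R)" for R :: real
        by (simp add: exp_diff exp_minus divide_inverse)
      then show ?thesis
        using tilt by (simp only: exp_diff[of "s n * _"])
    qed
    also have "\<dots> \<le> 2 * measure M ?W"
      using half by (simp add: pos_divide_le_eq mult_ac)
    finally show ?case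
      by simp
  qed
qed

end

context gaussian_mgf_limit
begin

lemma upper_bound:
  assumes B: "B \<in> sets borel"
  shows "limsup (\<lambda>n. ereal (1 / s n) * ln_ext (measure M {x \<in> space M. Y n x \<in> B}))
    \<le> - (INF y\<in>closure B. ereal (y\<^sup>2 / (2 * v)))" (is "limsup ?L \<le> - ?I")
proof (rule dense_ge)
  fix z :: ereal assume "- ?I < z"
  then obtain c' where c': "- ?I < ereal c'" "ereal c' < z"
    using ereal_dense2 by blast
  then have "ereal (- c') < ?I"
    by (simp add: ereal_uminus_less_reorder)
  then obtain c where c: "ereal (- c') < ereal c" "ereal c < ?I"
    using ereal_dense2 by blast
  \<comment> \<open>one half of the slack is for \<open>tail_le\<close>, the other for the factor \<open>2\<close> there\<close>
  define \<epsilon> where "\<epsilon> = (c + c') / 2"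
  have \<epsilon>: "0 < \<epsilon>" and \<epsilon>2: "2 * \<epsilon> = c + c'"
    using c by (simp_all add: \<epsilon>_def)
  \<comment> \<open>\<open>B\<close> does not meet the interval where the rate function is below \<open>c\<close>\<close>
  define r where "r = sqrt (2 * v * max c 0)"
  have r: "0 \<le> r" "r\<^sup>2 / (2 * v) = max c 0"
    using v_pos by (simp_all add: r_def)
  have sub: "{x \<in> space M. Y n x \<in> B} \<subseteq> {x \<in> space M. r \<le> \<bar>Y n x\<bar>}" for n
  proof safe
    fix x assume "Y n x \<in> B"
    then have "?I \<le> ereal ((Y n x)\<^sup>2 / (2 * v))"
      using closure_subset by (intro INF_lower) auto
    then have "c < (Y n x)\<^sup>2 / (2 * v)"
      using c(2) by (metis less_ereal.simps(1) order_less_le_trans)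
    then have "max c 0 \<le> (Y n x)\<^sup>2 / (2 * v)"
      using v_pos by simp
    then have "2 * v * max c 0 \<le> 2 * v * ((Y n x)\<^sup>2 / (2 * v))"
      using v_pos by (intro mult_left_mono) auto
    then have "2 * v * max c 0 \<le> (Y n x)\<^sup>2"
      using v_pos by simp
    then have "r \<le> sqrt ((Y n x)\<^sup>2)"
      unfolding r_def by (rule real_sqrt_le_mono)
    then show "r \<le> \<bar>Y n x\<bar>"
      by simp
  qed
  have "filterlim (\<lambda>n. \<epsilon> * s n) at_top sequentially"
    by (rule filterlim_tendsto_pos_mult_at_top[OF tendsto_const \<epsilon> s_lim])
  then have "\<forall>\<^sub>F n in sequentially. ln 2 \<le> \<epsilon> * s n"
    unfolding filterlim_at_top by blast
  then have "\<forall>\<^sub>F n in sequentially. ?L n \<le> ereal c'"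
    using tail_le[OF r(1) \<epsilon>] eventually_ge_at_top[of "1::nat"]
  proof eventually_elim
    case (elim n)
    have s: "0 < s n"
      using s_pos elim by simp
    let ?p = "measure M {x \<in> space M. Y n x \<in> B}"
    have "?p \<le> measure M {x \<in> space M. r \<le> \<bar>Y n x\<bar>}"
      by (rule finite_measure_mono[OF sub]) simp
    also have "\<dots> \<le> 2 * exp (- (s n * (max c 0 - \<epsilon>)))"
      using elim r(2) by simp
    finally have p: "?p \<le> 2 * exp (- (s n * (max c 0 - \<epsilon>)))" .
    show ?case
    proof (cases "?p = 0")
      case True
      then show ?thesis
        using s by (simp add: ln_ext_def)
    next
      case False
      then have pos: "0 < ?p"
        by (simp add: zero_less_measure_iff)
      then have "ln ?p \<le> ln (2 * exp (- (s n * (max c 0 - \<epsilon>))))"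
        using p by (subst ln_le_cancel_iff) auto
      also have "\<dots> = ln 2 - s n * (max c 0 - \<epsilon>)"
        by (simp add: ln_mult)
      also have "\<dots> \<le> s n * c'"
      proof -
        have "s n * (2 * \<epsilon> - max c 0) \<le> s n * c'"
          using s \<epsilon>2 by (intro mult_left_mono) auto
        then show ?thesis
          using elim(1) by (simp add: algebra_simps)
      qed
      finally have "1 / s n * ln ?p \<le> c'"
        using s by (simp add: pos_divide_le_eq mult.commute)
      then show ?thesis
        using False by (simp add: ln_ext_def)
    qed
  qed
  then have "limsup ?L \<le> ereal c'"
    by (rule Limsup_bounded)
  then show "limsup ?L \<le> z"
    using c'(2) by simp
qed

lemma lower_bound:
  assumes B: "B \<in> sets borel"
  shows "- (INF y\<in>interior B. ereal (y\<^sup>2 / (2 * v)))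
    \<le> liminf (\<lambda>n. ereal (1 / s n) * ln_ext (measure M {x \<in> space M. Y n x \<in> B}))" (is "- ?I \<le> liminf ?L")
proof -
  have "- liminf ?L \<le> ?I"
  proof (rule INF_greatest)
    fix y assume y: "y \<in> interior B"
    obtain d0 where d0: "0 < d0" "ball y d0 \<subseteq> B"
      using y by (auto simp: mem_interior)
    have "- ereal (y\<^sup>2 / (2 * v)) \<le> liminf ?L + ereal (2 * \<epsilon>)" if \<epsilon>: "0 < \<epsilon>" for \<epsilon>
    proof -
      define d where "d = min d0 (\<epsilon> * v / (\<bar>y\<bar> + 1))"
      have d: "0 < d" "d \<le> d0"
        using d0 \<epsilon> v_pos by (auto simp: d_def)
      have "\<bar>y\<bar> * d \<le> (\<bar>y\<bar> + 1) * (\<epsilon> * v / (\<bar>y\<bar> + 1))"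
        using d by (intro mult_mono) (auto simp: d_def)
      then have yd: "\<bar>y\<bar> * d / v \<le> \<epsilon>"
        using v_pos by (simp add: pos_divide_le_eq)
      have sub: "{x \<in> space M. \<bar>Y n x - y\<bar> < d} \<subseteq> {x \<in> space M. Y n x \<in> B}" for n
        using d0(2) d(2) by (auto simp: subset_eq dist_real_def abs_minus_commute)
      have "\<forall>\<^sub>F n in sequentially. ereal (- (y\<^sup>2 / (2 * v)) - 2 * \<epsilon>) \<le> ?L n"
        using window_ge[OF d(1) \<epsilon>, of y] eventually_ge_at_top[of "1::nat"]
      proof eventually_elim
        case (elim n)
        have s: "0 < s n"
          using s_pos elim by simp
        let ?p = "measure M {x \<in> space M. Y n x \<in> B}"
        have B' [measurable]: "B \<in> sets borel"
          by (rule B)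
        have "s n * (y\<^sup>2 / (2 * v) + \<bar>y\<bar> * d / v + \<epsilon>) \<le> s n * (y\<^sup>2 / (2 * v) + 2 * \<epsilon>)"
          using yd s by (intro mult_left_mono) auto
        then have "exp (- (s n * (y\<^sup>2 / (2 * v) + 2 * \<epsilon>))) \<le> exp (- (s n * (y\<^sup>2 / (2 * v) + \<bar>y\<bar> * d / v + \<epsilon>)))"
          by simp
        also have "\<dots> \<le> measure M {x \<in> space M. \<bar>Y n x - y\<bar> < d}"
          using elim by simp
        also have "\<dots> \<le> ?p"
          by (rule finite_measure_mono[OF sub]) measurable
        finally have p: "exp (- (s n * (y\<^sup>2 / (2 * v) + 2 * \<epsilon>))) \<le> ?p" .
        then have pos: "0 < ?p"
          by (meson exp_gt_zero order_less_le_trans)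
        have "ln (exp (- (s n * (y\<^sup>2 / (2 * v) + 2 * \<epsilon>)))) \<le> ln ?p"
          using p pos by (subst ln_le_cancel_iff) auto
        moreover have "(- b - 2 * \<epsilon>) * s n = - (s n * (b + 2 * \<epsilon>))" for b
          by (simp add: algebra_simps)
        ultimately have "(- (y\<^sup>2 / (2 * v)) - 2 * \<epsilon>) * s n \<le> ln ?p"
          by (simp only: ln_exp)
        then have "- (y\<^sup>2 / (2 * v)) - 2 * \<epsilon> \<le> ln ?p / s n"
          by (simp only: pos_le_divide_eq[OF s])
        then show ?case
          using pos by (simp add: ln_ext_def)
      qed
      then have "ereal (- (y\<^sup>2 / (2 * v)) - 2 * \<epsilon>) \<le> liminf ?L"
        by (rule Liminf_bounded)
      then have "ereal (- (y\<^sup>2 / (2 * v)) - 2 * \<epsilon>) + ereal (2 * \<epsilon>) \<le> liminf ?L + ereal (2 * \<epsilon>)"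
        by (rule add_right_mono)
      then show ?thesis
        by simp
    qed
    note bound = this
    have "- ereal (y\<^sup>2 / (2 * v)) \<le> liminf ?L"
    proof (rule ereal_le_epsilon2)
      fix e :: real assume "0 < e"
      then show "- ereal (y\<^sup>2 / (2 * v)) \<le> liminf ?L + ereal e"
        using bound[of "e / 2"] by simp
    qed
    then show "- liminf ?L \<le> ereal (y\<^sup>2 / (2 * v))"
      by (simp only: ereal_uminus_le_reorder)
  qed
  then show ?thesis
    by (simp only: ereal_uminus_le_reorder)
qed

end

section \<open>Moderate deviations of the stationary sequence\<close>

text \<open>Since \<open>T\<close> is bijective, \<open>F0 \<subseteq> T\<^sup>-\<^sup>1 F0\<close> says that \<open>T\<close> maps sets of \<open>F0\<close> to sets of \<open>F0\<close>.\<close>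

lemma measurable_inverse_of_filtration:
  assumes sub: "subalgebra M F0"
    and bij: "bij_betw T (space M) (space M)"
    and incr: "sets F0 \<subseteq> sets (vimage_algebra (space M) T F0)"
  shows "inv_into (space M) T \<in> measurable F0 F0"
proof (rule measurableI)
  let ?V = "inv_into (space M) T"
  have sp: "space F0 = space M"
    using sub by (simp add: subalgebra_def)
  show "?V x \<in> space F0" if "x \<in> space F0" for x
    using that bij by (simp add: sp bij_betw_def inv_into_into)
  fix A assume A: "A \<in> sets F0"
  have "T \<in> space M \<rightarrow> space F0"
    using bij by (auto simp: bij_betw_def sp)
  then have "sets (vimage_algebra (space M) T F0) = {T -` E \<inter> space M | E. E \<in> sets F0}"
    by (rule sets_vimage_algebra2)
  then obtain E where E: "E \<in> sets F0" "A = T -` E \<inter> space M"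
    using incr A by auto
  have "?V -` A \<inter> space M = E"
  proof (intro equalityI subsetI)
    fix x assume "x \<in> ?V -` A \<inter> space M"
    then show "x \<in> E"
      using E(2) bij by (auto simp: bij_betw_def f_inv_into_f)
  next
    fix x assume x: "x \<in> E"
    then have "x \<in> space M"
      using sets.sets_into_space[OF E(1)] sp by auto
    then show "x \<in> ?V -` A \<inter> space M"
      using E(2) x bij by (auto simp: bij_betw_def f_inv_into_f inv_into_into)
  qed
  then show "?V -` A \<inter> space F0 \<in> sets F0"
    using E(1) sp by simp
qed

lemma (in bounded_adapted) S_eq_psum: "S M T X0 n = psum n"
proof
  fix x
  have "S M T X0 n x = (\<Sum>i = 1..int n. X0 ((T ^^ nat i) x))"
    unfolding S_def X_def iter_def by (intro sum.cong) auto
  also have "\<dots> = (\<Sum>k<n. X0 ((T ^^ Suc k) x))"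
    by (rule sum.reindex_bij_witness[of _ "\<lambda>k. int (Suc k)" "\<lambda>i. nat i - 1"])
      (auto simp: Suc_nat_eq_nat_zadd1 simp del: funpow.simps)
  finally show "S M T X0 n x = psum n x"
    by (simp add: psum_def)
qed

lemma sqrt_ennreal_lessD:
  assumes "sqrt_ennreal x < ennreal \<eta>" "0 < \<eta>"
  shows "x < ennreal (\<eta>\<^sup>2)"
proof -
  have fin: "x \<noteq> \<infinity>"
    using assms(1) by (auto simp: sqrt_ennreal_def)
  then have "sqrt (enn2real x) < \<eta>"
    using assms by (simp add: sqrt_ennreal_def ennreal_less_iff)
  then have "enn2real x < \<eta>\<^sup>2"
    using assms(2) real_less_lsqrt real_sqrt_less_iff by (metis enn2real_nonneg real_sqrt_less_iff real_sqrt_unique less_imp_le)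
  then show ?thesis
    using fin by (metis enn2real_nonneg ennreal_enn2real ennreal_lessI infinity_ennreal_def le_less_trans top.not_eq_extremum)
qed

text \<open>Small \<open>gamma\<close> and \<open>delta\<close> at block length \<open>n\<close> make \<open>n\<close> a good block length.\<close>

lemma (in bounded_adapted) good_blockI:
  assumes n: "1 \<le> n" and \<eta>: "0 < \<eta>"
    and sig: "0 < sigma_n M T X0 n" "(sigma_n M T X0 n)\<^sup>2 \<le> w"
    and gam: "gamma M T X0 F n n < ennreal \<eta>" and del: "delta M T X0 F n n < ennreal \<eta>"
    and e: "\<eta> * sqrt w \<le> e" "\<eta>\<^sup>2 * w + \<bar>(sigma_n M T X0 n)\<^sup>2 - v\<bar> \<le> e"
  shows "good_block v e n"
proof -
  define \<tau> where "\<tau> = sigma_n M T X0 n"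
  have \<tau>: "0 < \<tau>" "\<tau>\<^sup>2 \<le> w" "\<tau> \<le> sqrt w"
    using sig by (auto simp: \<tau>_def intro: real_le_rsqrt)
  have n0: "0 < real n"
    using n by simp
  have dn: "norm_Linf M (real_cond_exp M F (S M T X0 k)) = ennreal (drift_norm k)" for k
    by (simp add: S_eq_psum ennreal_drift_norm drift_def)
  have series: "(\<Sum>j = 1..J. drift_norm (n * j) / real j powr (3 / 2)) \<le> e * sqrt (real n)" for J
  proof -
    let ?s = "\<Sum>j = 1..J. drift_norm (n * j) / real j powr (3 / 2)"
    have s0: "0 \<le> ?s"
      by (intro sum_nonneg) (simp add: drift_norm_nonneg)
    have "ennreal ?s = (\<Sum>k<J. ennreal (drift_norm (n * Suc k) / real (Suc k) powr (3 / 2)))"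
      by (subst sum_ennreal)
        (auto simp: drift_norm_nonneg sum.atLeast1_atMost_eq simp del: of_nat_Suc mult_Suc_right)
    also have "\<dots> = (\<Sum>k<J. ennreal (1 / real (Suc k) powr (3 / 2)) * ennreal (drift_norm (n * Suc k)))"
      by (intro sum.cong refl) (simp add: drift_norm_nonneg flip: ennreal_mult)
    also have "\<dots> \<le> (\<Sum>k. ennreal (1 / real (Suc k) powr (3 / 2)) * ennreal (drift_norm (n * Suc k)))"
      by (rule sum_le_suminf) auto
    finally have "ennreal (1 / (sqrt (real n) * \<tau>)) * ennreal ?s \<le> gamma M T X0 F n n"
      unfolding gamma_def Let_def dn \<tau>_def by (intro mult_left_mono) auto
    also have "\<dots> < ennreal \<eta>"
      by (rule gam)
    finally have "ennreal (1 / (sqrt (real n) * \<tau>) * ?s) < ennreal \<eta>"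
      using \<tau> n0 s0 by (subst ennreal_mult) auto
    then have "1 / (sqrt (real n) * \<tau>) * ?s < \<eta>"
      using \<tau> n0 s0 by (subst (asm) ennreal_less_iff) auto
    then have "?s < \<eta> * \<tau> * sqrt (real n)"
      using \<tau> n0 by (simp add: pos_divide_less_eq mult_ac)
    also have "\<dots> \<le> \<eta> * sqrt w * sqrt (real n)"
      using \<eta> \<tau> by (intro mult_right_mono mult_left_mono) auto
    also have "\<dots> \<le> e * sqrt (real n)"
      using e by (intro mult_right_mono) auto
    finally show ?thesis
      by simp
  qed
  have dsq: "delta_sq M T X0 F n n < ennreal (\<eta>\<^sup>2)"
    using del \<eta> unfolding delta_def by (rule sqrt_ennreal_lessD)
  have c0: "0 < 1 / (real n * \<tau>\<^sup>2)"
    using \<tau> n0 by simp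
  have tau_w: "\<eta>\<^sup>2 * \<tau>\<^sup>2 \<le> \<eta>\<^sup>2 * w"
    using \<tau> by (intro mult_left_mono) auto
  have "ennreal (1 / (real n * \<tau>\<^sup>2)) * (ennreal (drift_norm n))\<^sup>2 \<le> delta_sq M T X0 F n n"
    unfolding delta_sq_def dn \<tau>_def by simp
  also note dsq
  finally have "1 / (real n * \<tau>\<^sup>2) * (drift_norm n)\<^sup>2 < \<eta>\<^sup>2"
    using c0 by (simp add: drift_norm_nonneg ennreal_power ennreal_less_iff flip: ennreal_mult)
  then have "(drift_norm n)\<^sup>2 < \<eta>\<^sup>2 * \<tau>\<^sup>2 * real n"
    using \<tau> n0 by (simp add: pos_divide_less_eq mult_ac)
  also have "\<dots> \<le> e * real n"
    using tau_w e by (intro mult_right_mono) auto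
  finally have mean: "(drift_norm n)\<^sup>2 \<le> e * real n"
    by simp
  let ?cs = "real_cond_exp M F (\<lambda>x. (psum n x)\<^sup>2)"
  let ?h = "\<lambda>x. 1 / (real n * \<tau>\<^sup>2) * ?cs x - 1"
  have h: "ebdd ?h"
    by (intro ebdd_intros ebdd_cond_exp psum_ebdd)
  have "norm_Linf M ?h \<le> delta_sq M T X0 F n n"
    unfolding delta_sq_def S_eq_psum \<tau>_def by simp
  then have "norm_Linf M ?h \<le> ennreal (\<eta>\<^sup>2)"
    using dsq by simp
  then have nh: "enn2real (norm_Linf M ?h) \<le> \<eta>\<^sup>2"
    using enn2real_mono[of _ "ennreal (\<eta>\<^sup>2)"] by simp
  have var: "AE x in M. \<bar>?cs x - real n * v\<bar> \<le> e * real n"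
    using norm_Linf_ebdd(2)[OF h]
  proof eventually_elim
    case (elim x)
    have "?cs x - real n * \<tau>\<^sup>2 = real n * \<tau>\<^sup>2 * ?h x"
      using \<tau> n0 by (simp add: right_diff_distrib)
    then have "\<bar>?cs x - real n * \<tau>\<^sup>2\<bar> = real n * \<tau>\<^sup>2 * \<bar>?h x\<bar>"
      by (simp add: abs_mult)
    also have "\<dots> \<le> real n * \<tau>\<^sup>2 * \<eta>\<^sup>2"
      using elim nh by (intro mult_left_mono) auto
    finally have 1: "\<bar>?cs x - real n * \<tau>\<^sup>2\<bar> \<le> real n * (\<eta>\<^sup>2 * w)"
      using mult_left_mono[OF tau_w, of "real n"] by (simp add: mult_ac)
    have 2: "\<bar>real n * \<tau>\<^sup>2 - real n * v\<bar> = real n * \<bar>\<tau>\<^sup>2 - v\<bar>"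
      by (simp add: abs_mult flip: right_diff_distrib)
    have "real n * (\<eta>\<^sup>2 * w) + real n * \<bar>\<tau>\<^sup>2 - v\<bar> \<le> real n * e"
      using mult_left_mono[OF e(2), of "real n"] by (simp add: \<tau>_def distrib_left)
    then show ?case
      using 1 2 by (simp add: mult.commute)
  qed
  show ?thesis
    unfolding good_block_def using n series mean var by blast
qed

theorem corollary2p3:
  fixes M F0 :: "'a measure" and T :: "'a \<Rightarrow> 'a" and X0 :: "'a \<Rightarrow> real"
    and \<sigma> :: real and a :: "nat \<Rightarrow> real" and B :: "real set"
  assumes prob: "prob_space M"
    and T_bij: "bij_betw T (space M) (space M)"
    and T_meas: "T \<in> measurable M M"
    and T_inv_meas: "inv_into (space M) T \<in> measurable M M"
    and T_pres: "distr M M T = M"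
    and F0_sub: "subalgebra M F0"
    and F0_incr: "sets F0 \<subseteq> sets (vimage_algebra (space M) T F0)"
    and X0_adapted: "X0 \<in> borel_measurable F0"
    and X0_bounded: "norm_Linf M X0 < \<infinity>"
    and X0_centered: "(\<integral>\<omega>. X0 \<omega> \<partial>M) = 0"
    and sigma_n_pos: "\<And>n. n \<ge> 1 \<Longrightarrow> sigma_n M T X0 n > 0"
    and sigma_lim: "(\<lambda>n. (sigma_n M T X0 n)\<^sup>2) \<longlonglongrightarrow> \<sigma>\<^sup>2"
    and sigma_pos: "\<sigma>\<^sup>2 > 0"
    and gamma_delta: "\<And>m :: nat \<Rightarrow> nat.
          (\<And>n. n \<ge> 1 \<Longrightarrow> 1 \<le> m n \<and> m n \<le> n) \<Longrightarrow>
          filterlim m at_top sequentially \<Longrightarrow>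
          (\<lambda>n. max (gamma M T X0 F0 n (m n)) (delta M T X0 F0 n (m n))) \<longlonglongrightarrow> 0"
    and a_pos: "\<And>n. n \<ge> 1 \<Longrightarrow> a n > 0"
    and a_lim: "a \<longlonglongrightarrow> 0"
    and a_growth: "filterlim (\<lambda>n. a n * sqrt (real n)) at_top sequentially"
    and B_borel: "B \<in> sets borel"
  shows "- (INF x\<in>interior B. ereal (x\<^sup>2 / (2 * \<sigma>\<^sup>2)))
           \<le> liminf (\<lambda>n. ereal ((a n)\<^sup>2) *
                 ln_ext (measure M {\<omega> \<in> space M. a n * W M T X0 n \<omega> \<in> B}))
       \<and> liminf (\<lambda>n. ereal ((a n)\<^sup>2) *
                 ln_ext (measure M {\<omega> \<in> space M. a n * W M T X0 n \<omega> \<in> B}))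
           \<le> limsup (\<lambda>n. ereal ((a n)\<^sup>2) *
                 ln_ext (measure M {\<omega> \<in> space M. a n * W M T X0 n \<omega> \<in> B}))
       \<and> limsup (\<lambda>n. ereal ((a n)\<^sup>2) *
                 ln_ext (measure M {\<omega> \<in> space M. a n * W M T X0 n \<omega> \<in> B}))
           \<le> - (INF x\<in>closure B. ereal (x\<^sup>2 / (2 * \<sigma>\<^sup>2)))"
proof -
  let ?V = "inv_into (space M) T"
  define v where "v = \<sigma>\<^sup>2"
  have v: "0 < v"
    using sigma_pos by (simp add: v_def)
  interpret prob_space M
    by (rule prob)
  interpret invertible_system M F0 T ?V
  proof
    show "?V \<in> measurable F0 F0"
      by (rule measurable_inverse_of_filtration[OF F0_sub T_bij F0_incr])
    show "?V (T x) = x" if "x \<in> space M" for x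
      using T_bij that by (simp add: bij_betw_def)
    show "T (?V x) = x" if "x \<in> space M" for x
      using T_bij that by (simp add: bij_betw_def f_inv_into_f)
  qed (fact F0_sub T_meas T_inv_meas T_pres)+
  interpret bounded_adapted M F0 T ?V X0 "enn2real (norm_Linf M X0)"
  proof
    have "AE x in M. ennreal \<bar>X0 x\<bar> \<le> norm_Linf M X0"
      unfolding norm_Linf_def by (rule esssup_AE)
    then show "AE x in M. \<bar>X0 x\<bar> \<le> enn2real (norm_Linf M X0)"
    proof eventually_elim
      case (elim x)
      then show ?case
        using enn2real_mono[OF elim] X0_bounded by simp
    qed
  qed (use X0_adapted X0_centered in auto)
  have good: "\<exists>m. good_block v e m" if e: "0 < e" for e
  proof -
    define w where "w = 2 * v"
    \<comment> \<open>so that both \<open>\<eta> w\<^sup>1\<^sup>/\<^sup>2 \<le> e\<close> and \<open>\<eta>\<^sup>2 w \<le> e / 2\<close>\<close>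
    define \<eta> where "\<eta> = sqrt (min (e\<^sup>2) (e / 2) / w)"
    have w: "0 < w"
      using v by (simp add: w_def)
    then have \<eta>: "0 < \<eta>" "\<eta>\<^sup>2 * w = min (e\<^sup>2) (e / 2)"
      using e by (auto simp: \<eta>_def)
    have "(\<eta> * sqrt w)\<^sup>2 \<le> e\<^sup>2"
      using \<eta>(2) w by (simp add: power_mult_distrib)
    then have e1: "\<eta> * sqrt w \<le> e"
      by (rule power2_le_imp_le) (use e in simp)
    \<comment> \<open>blocks of length \<open>n\<close>, that is \<open>m(n) = n\<close>\<close>
    have "(\<lambda>n. max (gamma M T X0 F0 n n) (delta M T X0 F0 n n)) \<longlonglongrightarrow> 0"
      by (rule gamma_delta) (auto simp: filterlim_ident)
    then have "\<forall>\<^sub>F n in sequentially. max (gamma M T X0 F0 n n) (delta M T X0 F0 n n) < ennreal \<eta>"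
      using \<eta> by (intro order_tendstoD) auto
    moreover have "\<forall>\<^sub>F n in sequentially. dist ((sigma_n M T X0 n)\<^sup>2) v < min v (e / 2)"
      using sigma_lim v e unfolding v_def by (intro tendstoD) auto
    ultimately have "\<forall>\<^sub>F n in sequentially. good_block v e n"
      using eventually_ge_at_top[of "1::nat"]
    proof eventually_elim
      case (elim n)
      have "\<bar>(sigma_n M T X0 n)\<^sup>2 - v\<bar> < v" "\<bar>(sigma_n M T X0 n)\<^sup>2 - v\<bar> < e / 2"
        using elim by (auto simp: dist_real_def)
      then have "\<eta>\<^sup>2 * w + \<bar>(sigma_n M T X0 n)\<^sup>2 - v\<bar> \<le> e" "(sigma_n M T X0 n)\<^sup>2 \<le> w"
        using \<eta>(2) unfolding w_def by linarith+
      then show ?case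
        using elim \<eta>(1) e1 sigma_n_pos by (intro good_blockI[of n \<eta> w]) auto
    qed
    then show ?thesis
      by (auto simp: eventually_sequentially)
  qed
  define Y where "Y n x = a n * W M T X0 n x" for n x
  have Y: "Y n x = a n / sqrt (real n) * psum n x" for n x
    by (simp add: Y_def W_def S_eq_psum)
  have Y_ebdd: "ebdd (Y n)" for n
    unfolding Y[abs_def] by (intro ebdd_cmult psum_ebdd)
  have scale: "c * (1 / (a n)\<^sup>2) * Y n x = c / (a n * sqrt (real n)) * psum n x" if "1 \<le> n" for c n x
    using a_pos[OF that] by (simp add: Y power2_eq_square)
  have mgf_Y: "(\<integral>x. exp (c * (1 / (a n)\<^sup>2) * Y n x) \<partial>M) = mgf n (c / (a n * sqrt (real n)))" if "1 \<le> n" for c n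
    unfolding mgf_def scale[OF that] ..
  interpret gaussian_mgf_limit M Y "\<lambda>n. 1 / (a n)\<^sup>2" v
  proof
    show "Y n \<in> borel_measurable M" for n
      by (rule ebdd_meas[OF Y_ebdd])
    show "integrable M (\<lambda>x. exp (c * Y n x))" for c n
      by (intro ebdd_integrable ebdd_exp ebdd_cmult Y_ebdd)
    show "0 < 1 / (a n)\<^sup>2" if "1 \<le> n" for n
      using a_pos[OF that] by simp
    have "\<forall>\<^sub>F n in sequentially. 0 < (a n)\<^sup>2"
      using eventually_ge_at_top[of "1::nat"] by eventually_elim (use a_pos in force)
    moreover have "(\<lambda>n. (a n)\<^sup>2) \<longlonglongrightarrow> 0"
      using tendsto_power[OF a_lim, of 2] by simp
    ultimately have "filterlim (\<lambda>n. inverse ((a n)\<^sup>2)) at_top sequentially"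
      by (intro filterlim_inverse_at_top) auto
    then show "filterlim (\<lambda>n. 1 / (a n)\<^sup>2) at_top sequentially"
      by (simp add: inverse_eq_divide)
    show "0 < v"
      by (rule v)
    fix c \<epsilon> :: real assume \<epsilon>: "0 < \<epsilon>"
    have up: "\<forall>\<^sub>F n in sequentially. mgf n (c / (a n * sqrt (real n))) \<le> exp ((c\<^sup>2 * v / 2 + \<epsilon>) / (a n)\<^sup>2)"
      using good v a_pos a_lim a_growth \<epsilon> by (intro mgf_eventually_le) auto
    have lo: "\<forall>\<^sub>F n in sequentially. exp ((c\<^sup>2 * v / 2 - \<epsilon>) / (a n)\<^sup>2) \<le> mgf n (c / (a n * sqrt (real n)))"
      using good v a_pos a_lim a_growth \<epsilon> by (intro mgf_eventually_ge) auto
    show "\<forall>\<^sub>F n in sequentially. (\<integral>x. exp (c * (1 / (a n)\<^sup>2) * Y n x) \<partial>M) \<le> exp (1 / (a n)\<^sup>2 * (c\<^sup>2 * v / 2 + \<epsilon>))"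
      using up eventually_ge_at_top[of "1::nat"]
      by eventually_elim (simp only: mgf_Y, simp)
    show "\<forall>\<^sub>F n in sequentially. exp (1 / (a n)\<^sup>2 * (c\<^sup>2 * v / 2 - \<epsilon>)) \<le> (\<integral>x. exp (c * (1 / (a n)\<^sup>2) * Y n x) \<partial>M)"
      using lo eventually_ge_at_top[of "1::nat"]
      by eventually_elim (simp only: mgf_Y, simp)
  qed
  show ?thesis
    using lower_bound[OF B_borel] upper_bound[OF B_borel]
    by (simp add: v_def Y_def Liminf_le_Limsup)
qed

end
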